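(* Let $r\ge 0$, $0<\rho\le 1$, $D,H,\gamma>0$ (with $\gamma$ sufficiently small, e.g. $\gamma\le 2/3$, so that $\tilde F^{r,\rho}(1)$ contains small perturbations of the constant density $1$). There exist positive constants $c^{\rm det}_{\rm res},c^{\rm rand}_{\rm res},c^{\rm quant}_{\rm res},c^{\rm det}_{\rm abs},c^{\rm rand}_{\rm abs},c^{\rm quant}_{\rm abs}$ and $\varepsilon_0>0$ such that for every $\varepsilon\in(0,\varepsilon_0)$: $$\mathrm{comp}^{\rm det}_{\varepsilon,{\rm res}}(F^{r,\rho}(1))\ge c^{\rm det}_{\rm res}\,\varepsilon^{-1/(r+\rho)},\quad \mathrm{comp}^{\rm rand}_{\varepsilon,{\rm res}}(F^{r,\rho}(1))\ge c^{\rm rand}_{\rm res}\,\varepsilon^{-1/(r+\rho+1/2)},\quad \mathrm{comp}^{\rm quant}_{\varepsilon,{\rm res}}(F^{r,\rho}(1))\ge c^{\rm quant}_{\rm res}\,\varepsilon^{-1/(r+\rho+1)},$$ $$\mathrm{comp}^{\rm det}_{\varepsilon,{\rm abs}}(\tilde F^{r,\rho}(1))\ge c^{\rm det}_{\rm abs}\,\varepsilon^{-1/(r+\rho)},\quad \mathrm{comp}^{\rm rand}_{\varepsilon,{\rm abs}}(\tilde F^{r,\rho}(1))\ge c^{\rm rand}_{\rm abs}\,\varepsilon^{-1/(r+\rho+1/2)},\quad \mathrm{comp}^{\rm quant}_{\varepsilon,{\rm abs}}(\tilde F^{r,\rho}(1))\ge c^{\rm quant}_{\rm abs}\,\vareps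ilon^{-1/(r+\rho+1)}.$$
   Context: Function classes. For $r\ge0$ integer, $0<\rho\le1$, $D,H>0$: $F^{r,\rho}$ is the set of $f\in C^r([0,1])$ with $|f^{(i)}(x)|\le D$ for $i=0,\dots,r$, $x\in[0,1]$, and $|f^{(r)}(x)-f^{(r)}(y)|\le H|x-y|^\rho$ for $x,y\in[0,1]$. $F^{r,\rho}(1)=\{f\in F^{r,\rho}: f\ge0 \text{ on }[0,1],\ \int_0^1 f=1\}$ (probability densities). For a constant $\gamma>0$, $\tilde F^{r,\rho}(1)=\{f\in F^{r,\rho}(1): f(x)\ge\gamma\ \forall x\in[0,1]\}$. Problem. For a density $f$, the median is a point $\xi\in[0,1]$ with $\int_0^\xi f(t)\,dt=1/2$ (unique when $f\ge\gamma>0$). An algorithm outputs $\hat\xi\in[0,1]$. Absolute error: $e_{\rm abs}(f)=|\hat\xi-\xi|$; residual error: $e_{\rm res}(f)=\left|\int_0^{\hat\xi}f(t)\,dt-\tfrac12\right|$. Settings. Deterministic: the algorithm uses at most $n$ values of $f$ or its derivatives of order $\le r$ at adaptively chosen points of $[0,1]$ (adaptive stopping allowed), then computes $\hat\xi$ from them; error over class $F$ is $\sup_{f\in F}e(f)$; cost is the number of such evaluations. Randomized: points/derivative orders/stopping may additionally depend on a random element $\omega$ of a probability space; cost is the supremum over $f\in F$ of the expected number of evaluations; error is $\sup_{f\in F}(\mathbb E_\omega[e^\omega(f)^2])^{1/2}$. Quantum: the algorithm is a sequence of unitary operations including applications of the standard quantum query operator for $f$ (the quantum analogue of evaluating $f$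 or its derivatives), with measurements and classical post-processing; cost is the number of query applications; error is $\sup_{f\in F}\inf\{\alpha: \mathbb P(e^\omega(f)>\alpha)\le 1/4\}$ (i.e. precision achieved with probability at least $3/4$). For $\#\in\{{\rm det},{\rm rand},{\rm quant}\}$ and criterion ${\rm crit}\in\{{\rm abs},{\rm res}\}$, the $\varepsilon$-complexity $\mathrm{comp}^{\#}_{\varepsilon,{\rm crit}}(F)$ is the infimum of the cost over all algorithms in that setting whose error on $F$ in that criterion is at most $\varepsilon$.
   Formalization: Proved for D>1 (for D≤1 the density class is empty or {1}, so the complexity is 0 and the bounds fail) and γ≤2/3; randomized constants are stated per type of sample space, one universal type (that of deterministic algorithms) sufficing. *)

theory Defs
  imports "HOL-Probability.Probability"
begin

fun dd :: "(real \<Rightarrow> real) \<Rightarrow> nat \<Rightarrow> real \<Rightarrow> real" where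
  "dd f 0 = f"
| "dd f (Suc j) = (\<lambda>x. SOME d. (dd f j has_real_derivative d) (at x within {0..1}))"

definition Fclass :: "nat \<Rightarrow> real \<Rightarrow> real \<Rightarrow> real \<Rightarrow> (real \<Rightarrow> real) set" where
  "Fclass r \<rho> D H = {f.
      (\<forall>j<r. \<forall>x\<in>{0..1}. (dd f j has_real_derivative dd f (Suc j) x) (at x within {0..1}))
    \<and> continuous_on {0..1} (dd f r)
    \<and> (\<forall>i\<le>r. \<forall>x\<in>{0..1}. \<bar>dd f i x\<bar> \<le> D)
    \<and> (\<forall>x\<in>{0..1}. \<forall>y\<in>{0..1}. \<bar>dd f r x - dd f r y\<bar> \<le> H * \<bar>x - y\<bar> powr \<rho>)}"

definition Fdens :: "nat \<Rightarrow> real \<Rightarrow> real \<Rightarrow> real \<Rightarrow> (real \<Rightarrow> real) set" where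
  "Fdens r \<rho> D H = {f \<in> Fclass r \<rho> D H. (\<forall>x\<in>{0..1}. 0 \<le> f x) \<and> integral {0..1} f = 1}"

definition Fdens_low :: "nat \<Rightarrow> real \<Rightarrow> real \<Rightarrow> real \<Rightarrow> real \<Rightarrow> (real \<Rightarrow> real) set" where
  "Fdens_low r \<rho> D H \<gamma> = {f \<in> Fdens r \<rho> D H. \<forall>x\<in>{0..1}. \<gamma> \<le> f x}"

definition median :: "(real \<Rightarrow> real) \<Rightarrow> real" where
  "median f = (THE \<xi>. \<xi> \<in> {0..1} \<and> integral {0..\<xi>} f = 1/2)"

definition err_abs :: "(real \<Rightarrow> real) \<Rightarrow> real \<Rightarrow> real" where
  "err_abs f \<xi>h = \<bar>\<xi>h - median f\<bar>"

definition err_res :: "(real \<Rightarrow> real) \<Rightarrow> real \<Rightarrow> real" where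
  "err_res f \<xi>h = \<bar>integral {0..\<xi>h} f - 1/2\<bar>"

text \<open>An adaptive deterministic algorithm: given the information obtained so far (list of values),
  it chooses the next query (point x, derivative order j), decides whether to stop, and
  computes the output from the information.\<close>
record detalg =
  query :: "real list \<Rightarrow> real \<times> nat"
  stop  :: "real list \<Rightarrow> bool"
  out   :: "real list \<Rightarrow> real"

fun info :: "detalg \<Rightarrow> (real \<Rightarrow> real) \<Rightarrow> nat \<Rightarrow> real list" where
  "info A f 0 = []"
| "info A f (Suc k) = (case query A (info A f k) of (x, j) \<Rightarrow> info A f k @ [dd f j x])"

definition dcost :: "detalg \<Rightarrow> (real \<Rightarrow> real) \<Rightarrow> enat" where
  "dcost A f = (if \<exists>k. stop A (info A f k) then enat (LEAST k. stop A (info A f k)) else \<infinity>)"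

definition dout :: "detalg \<Rightarrow> (real \<Rightarrow> real) \<Rightarrow> real" where
  "dout A f = out A (info A f (LEAST k. stop A (info A f k)))"

definition det_adm :: "nat \<Rightarrow> detalg \<Rightarrow> bool" where
  "det_adm r A = (\<forall>ys. fst (query A ys) \<in> {0..1} \<and> snd (query A ys) \<le> r \<and> out A ys \<in> {0..1})"

definition comp_det :: "nat \<Rightarrow> (real \<Rightarrow> real) set \<Rightarrow> ((real \<Rightarrow> real) \<Rightarrow> real \<Rightarrow> real) \<Rightarrow> real \<Rightarrow> ennreal" where
  "comp_det r F e \<epsilon> =
     (INF A \<in> {A. det_adm r A \<and> (\<forall>f\<in>F. e f (dout A f) \<le> \<epsilon>)}.
        (SUP f\<in>F. ennreal_of_enat (dcost A f)))"

definition rand_adm :: "nat \<Rightarrow> (real \<Rightarrow> real) set \<Rightarrow> 'w measure \<Rightarrow> ('w \<Rightarrow> detalg) \<Rightarrow> bool" where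
  "rand_adm r F M A = (prob_space M \<and> (\<forall>\<omega>\<in>space M. det_adm r (A \<omega>))
      \<and> (\<forall>f\<in>F. (\<lambda>\<omega>. dcost (A \<omega>) f) \<in> measurable M (count_space UNIV)
               \<and> (\<lambda>\<omega>. dout (A \<omega>) f) \<in> borel_measurable M))"

definition rcost :: "(real \<Rightarrow> real) set \<Rightarrow> 'w measure \<Rightarrow> ('w \<Rightarrow> detalg) \<Rightarrow> ennreal" where
  "rcost F M A = (SUP f\<in>F. \<integral>\<^sup>+ \<omega>. ennreal_of_enat (dcost (A \<omega>) f) \<partial>M)"

text \<open>Error condition sup_f (E e^2)^(1/2) \<le> eps, written as: for all f, E e^2 \<le> eps^2.\<close>
definition comp_rand :: "'w itself \<Rightarrow> nat \<Rightarrow> (real \<Rightarrow> real) set \<Rightarrow> ((real \<Rightarrow> real) \<Rightarrow> real \<Rightarrow> real) \<Rightarrow> real \<Rightarrow> ennreal" where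
  "comp_rand _ r F e \<epsilon> =
     (INF MA \<in> {(M :: 'w measure, A). rand_adm r F M A \<and>
                 (\<forall>f\<in>F. (\<integral>\<^sup>+ \<omega>. ennreal ((e f (dout (A \<omega>) f))\<^sup>2) \<partial>M) \<le> ennreal (\<epsilon>\<^sup>2))}.
        rcost F (fst MA) (snd MA))"

section \<open>Quantum setting (Heinrich's model)\<close>

definition unitary_mat :: "nat \<Rightarrow> (nat \<Rightarrow> nat \<Rightarrow> complex) \<Rightarrow> bool" where
  "unitary_mat N U = (\<forall>a<N. \<forall>b<N. (\<Sum>k<N. cnj (U k a) * U k b) = (if a = b then 1 else 0))"

definition mat_app :: "nat \<Rightarrow> (nat \<Rightarrow> nat \<Rightarrow> complex) \<Rightarrow> (nat \<Rightarrow> complex) \<Rightarrow> nat \<Rightarrow> complex" where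
  "mat_app N U v = (\<lambda>a. \<Sum>b<N. U a b * v b)"

text \<open>A quantum algorithm without measurement: a quantum query Q = (m, m', m'', Z, tau, beta)
  and unitaries U_0, ..., U_n on C^(2^m); tau maps Z to (point, derivative order).\<close>
record qawm =
  qm    :: nat
  qm1   :: nat
  qm2   :: nat
  qZ    :: "nat set"
  qtau  :: "nat \<Rightarrow> real \<times> nat"
  qbeta :: "real \<Rightarrow> nat"
  qn    :: nat
  qU    :: "nat \<Rightarrow> nat \<Rightarrow> nat \<Rightarrow> complex"

definition qawm_valid :: "nat \<Rightarrow> qawm \<Rightarrow> bool" where
  "qawm_valid r Q = (qm1 Q + qm2 Q \<le> qm Q \<and> qZ Q \<noteq> {} \<and> qZ Q \<subseteq> {..<2 ^ qm1 Q}
     \<and> (\<forall>i\<in>qZ Q. fst (qtau Q i) \<in> {0..1} \<and> snd (qtau Q i) \<le> r)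
     \<and> (\<forall>z. qbeta Q z < 2 ^ qm2 Q)
     \<and> (\<forall>j\<le>qn Q. unitary_mat (2 ^ qm Q) (qU Q j)))"

text \<open>Basis index l < 2^m is read as |i>|x>|y> with i = l div 2^(m-m') (m' bits),
  y = l mod 2^(m'') (m'' bits). The query maps |i>|x>|y> to |i>|x>|y xor beta(f^(j)(t))>
  for i in Z, tau(i) = (t,j), and leaves it unchanged otherwise.\<close>
definition qperm :: "qawm \<Rightarrow> (real \<Rightarrow> real) \<Rightarrow> nat \<Rightarrow> nat" where
  "qperm Q f l = (let i = l div 2 ^ (qm Q - qm1 Q); y = l mod 2 ^ qm2 Q in
      if i \<in> qZ Q then
        (case qtau Q i of (t, j) \<Rightarrow> l - y + (Bit_Operations.xor y (qbeta Q (dd f j t))))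
      else l)"

definition qquery :: "qawm \<Rightarrow> (real \<Rightarrow> real) \<Rightarrow> nat \<Rightarrow> nat \<Rightarrow> complex" where
  "qquery Q f a b = (if a = qperm Q f b then 1 else 0)"

fun qstate :: "qawm \<Rightarrow> (real \<Rightarrow> real) \<Rightarrow> nat \<Rightarrow> nat \<Rightarrow> complex" where
  "qstate Q f 0 = mat_app (2 ^ qm Q) (qU Q 0) (\<lambda>a. if a = 0 then 1 else 0)"
| "qstate Q f (Suc k) = mat_app (2 ^ qm Q) (qU Q (Suc k)) (mat_app (2 ^ qm Q) (qquery Q f) (qstate Q f k))"

definition qprob :: "qawm \<Rightarrow> (real \<Rightarrow> real) \<Rightarrow> nat \<Rightarrow> real" where
  "qprob Q f l = (cmod (qstate Q f (qn Q) l))\<^sup>2"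

text \<open>A quantum algorithm with k measurements: the l-th stage is a quantum algorithm without
  measurement chosen depending on the previous measurement outcomes; phi maps all outcomes
  to the output.\<close>
record qalg =
  qk     :: nat
  qstage :: "nat list \<Rightarrow> qawm"
  qphi   :: "nat list \<Rightarrow> real"

definition qvalid_prefix :: "qalg \<Rightarrow> nat list \<Rightarrow> bool" where
  "qvalid_prefix A xs = (\<forall>l<length xs. xs ! l < 2 ^ qm (qstage A (take l xs)))"

definition qoutcomes :: "qalg \<Rightarrow> nat list set" where
  "qoutcomes A = {xs. length xs = qk A \<and> qvalid_prefix A xs}"

definition qP :: "qalg \<Rightarrow> (real \<Rightarrow> real) \<Rightarrow> nat list \<Rightarrow> real" where
  "qP A f xs = (\<Prod>l<qk A. qprob (qstage A (take l xs)) f (xs ! l))"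

definition qalg_adm :: "nat \<Rightarrow> qalg \<Rightarrow> bool" where
  "qalg_adm r A = (1 \<le> qk A \<and> (\<forall>xs. qawm_valid r (qstage A xs)) \<and> (\<forall>xs. qphi A xs \<in> {0..1}))"

definition qcost :: "qalg \<Rightarrow> ennreal" where
  "qcost A = (\<Sum>l<qk A. (SUP ps \<in> {ps. length ps = l \<and> qvalid_prefix A ps}. ennreal (real (qn (qstage A ps)))))"

definition qerr :: "((real \<Rightarrow> real) \<Rightarrow> real \<Rightarrow> real) \<Rightarrow> (real \<Rightarrow> real) \<Rightarrow> qalg \<Rightarrow> real" where
  "qerr e f A = Inf {\<alpha>. 0 \<le> \<alpha> \<and>
      (\<Sum>xs\<in>qoutcomes A. if e f (qphi A xs) > \<alpha> then qP A f xs else 0) \<le> 1/4}"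

definition comp_quant :: "nat \<Rightarrow> (real \<Rightarrow> real) set \<Rightarrow> ((real \<Rightarrow> real) \<Rightarrow> real \<Rightarrow> real) \<Rightarrow> real \<Rightarrow> ennreal" where
  "comp_quant r F e \<epsilon> =
     (INF A \<in> {A. qalg_adm r A \<and> (\<forall>f\<in>F. qerr e f A \<le> \<epsilon>)}. qcost A)"

end

theory Submission
  imports Defs
begin

text \<open>
  Perturb the constant density on [0, 1/4] by a subset \<open>S\<close> of \<open>N\<close> disjoint scaled bumps and subtract
  copies of the same bumps on [3/4, 1]. The total mass stays 1, and the median moves by \<open>a * card S\<close>,
  where \<open>a\<close> is of order \<open>N powr - (r + \<rho> + 1)\<close>; both error criteria dominate the error of estimating
  this shift. An evaluation at one point reveals only whether a single index belongs to \<open>S\<close>. Hence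
  the three lower bounds reduce to estimating \<open>card S\<close> with a number of queries proportional to \<open>N\<close>:
  a deterministic algorithm is off by the number of indices it has not queried, a randomized one has
  at least the variance of the unqueried indices when \<open>S\<close> is uniformly random, and a quantum one
  cannot separate sets of cardinality \<open>k\<close> from sets of cardinality \<open>k + 1\<close> for \<open>N = 2 * k + 1\<close>,
  by Ambainis' adversary argument.
\<close>

section \<open>Bump functions\<close>

text \<open>Write \<open>s = r + \<rho>\<close>. A bump compressed to width
  \<open>1 / (4 * N)\<close> keeps a bounded Hoelder constant only if its height is of order
  \<open>N powr - s\<close>, and integration costs one more factor \<open>1 / N\<close>; this is the
  origin of the order of \<open>a\<close>. With too few queries the uncertainty about
  \<open>card S\<close> stays of order \<open>N\<close> for deterministic, \<open>sqrt N\<close> for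
  randomized and 1 for quantum algorithms, so the unavoidable errors are \<open>a * N\<close>,
  \<open>a * sqrt N\<close> and \<open>a\<close>. Equating each with \<epsilon> and solving for
  \<open>N\<close> gives the exponents \<open>s\<close>, \<open>s + 1/2\<close> and
  \<open>s + 1\<close>.

  The median is a nonlinear functional of the density, and this shapes the family: since the density
  is 1 on [1/4, 3/4], the distribution function there is the identity plus a constant, so the median
  is affine in \<open>card S\<close>, and both errors coincide for outputs in that range. Each
  compensating copy carries the index of its original, so that restoring mass 1 does not let an
  evaluation reveal a second index.\<close>

lemma pderiv_surj: "\<exists>Q. pderiv Q = (p :: real poly)"
proof -
  have "pderiv (\<Sum>i\<le>degree p. monom (coeff p i / real (Suc i)) (Suc i)) = (\<Sum>i\<le>degree p. monom (coeff p i) i)"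
    by (simp add: higher_pderiv_sum[where n = 1, simplified] pderiv_monom del: of_nat_Suc)
  then show ?thesis by (metis poly_as_sum_of_monoms)
qed

lemma power_dvd_pderiv:
  fixes q :: "real poly"
  assumes "q ^ Suc k dvd p" shows "q ^ k dvd pderiv p"
proof -
  obtain s where "p = q ^ Suc k * s" using assms by (auto elim: dvdE)
  then have "pderiv p = q ^ k * (q * pderiv s + smult (of_nat (Suc k)) (pderiv q) * s)"
    by (simp add: pderiv_mult pderiv_power_Suc algebra_simps del: power_Suc) (simp add: algebra_simps)
  then show ?thesis by simp
qed

lemma power_dvd_pderiv_iterate:
  fixes q :: "real poly"
  assumes "q ^ (k + j) dvd p" shows "q ^ k dvd (pderiv ^^ j) p"
  using assms
proof (induction j arbitrary: k)
  case (Suc j)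
  then have "q ^ Suc k dvd (pderiv ^^ j) p" using Suc.IH[of "Suc k"] by simp
  then show ?case using power_dvd_pderiv by simp
qed simp

text \<open>The pieces meet only at 0 and 1, where the values agree and both derivatives vanish. The
  outer function \<open>g\<close> need not be zero, so that the lemma also covers an antiderivative
  that takes different constants on the two sides.\<close>

lemma DERIV_glue_unit_interval:
  fixes f f' g :: "real \<Rightarrow> real"
  assumes f: "\<And>u. (f has_real_derivative f' u) (at u)"
    and g: "\<And>u. u \<le> 0 \<or> 1 \<le> u \<Longrightarrow> (g has_real_derivative 0) (at u)"
    and eq: "f 0 = g 0" "f 1 = g 1" "f' 0 = 0" "f' 1 = 0"
  shows "((\<lambda>u. if u \<in> {0..1} then f u else g u) has_real_derivative
           (if u \<in> {0..1} then f' u else 0)) (at u)"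
proof -
  have cl: "closure (- {0..1}) = {..0::real} \<union> {1..}"
  proof -
    have "- {0..1} = {..<0::real} \<union> {1<..}" by auto
    then show ?thesis by (simp only: closure_Un closure_lessThan closure_greaterThan)
  qed
  have "((\<lambda>u. if u \<in> {0..1} then f u else g u) has_vector_derivative
           (if u \<in> {0..1} then f' u else 0)) (at u within UNIV)"
  proof (rule has_vector_derivative_If_within_closures[where T = "- {0..1}"])
    show "(f has_vector_derivative f' u) (at u within {0..1} \<union> (closure {0..1} \<inter> closure (- {0..1})))"
      using f[of u] by (simp add: has_real_derivative_iff_has_vector_derivative has_vector_derivative_at_within)
    show "(g has_vector_derivative 0) (at u within - {0..1} \<union> (closure {0..1} \<inter> closure (- {0..1})))"
      if "u \<in> - {0..1} \<union> (closure {0..1} \<inter> closure (- {0..1}))"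
    proof -
      have "u \<le> 0 \<or> 1 \<le> u" using that by (auto simp: cl)
      from g[OF this] show ?thesis
        by (simp add: has_real_derivative_iff_has_vector_derivative has_vector_derivative_at_within)
    qed
    show "f u = g u" if "u \<in> closure {0..1}" "u \<in> closure (- {0..1})"
    proof -
      have "u = 0 \<or> u = 1" using that by (auto simp: cl)
      then show ?thesis using eq by auto
    qed
    show "f' u = 0" if "u \<in> closure {0..1}" "u \<in> closure (- {0..1})"
    proof -
      have "u = 0 \<or> u = 1" using that by (auto simp: cl)
      then show ?thesis using eq by auto
    qed
  qed auto
  then show ?thesis by (simp add: has_real_derivative_iff_has_vector_derivative)
qed

text \<open>\<open>B j\<close> is the \<open>j\<close>-th derivative of the bump, \<open>A\<close>
  its antiderivative and \<open>m\<close> its mass. One order beyond \<open>r\<close> is kept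
  because the bound on \<open>B (Suc r)\<close> makes \<open>B r\<close> Lipschitz, which gives the
  Hoelder condition. Since only finite smoothness is asked for, a truncated polynomial can serve as
  the bump.\<close>

locale bump =
  fixes r :: nat and B :: "nat \<Rightarrow> real \<Rightarrow> real" and A :: "real \<Rightarrow> real" and C m :: real
  assumes C_ge_1: "1 \<le> C" and m_pos: "0 < m" and m_le: "m \<le> C"
    and DERIV_A: "\<And>u. (A has_real_derivative B 0 u) (at u)"
    and DERIV_B: "\<And>j u. j \<le> r \<Longrightarrow> (B j has_real_derivative B (Suc j) u) (at u)"
    and B_le: "\<And>j u. j \<le> Suc r \<Longrightarrow> \<bar>B j u\<bar> \<le> C"
    and B_support: "\<And>j u. j \<le> Suc r \<Longrightarrow> u \<le> 0 \<or> 1 \<le> u \<Longrightarrow> B j u = 0"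
    and A_left: "\<And>u. u \<le> 0 \<Longrightarrow> A u = 0" and A_right: "\<And>u. 1 \<le> u \<Longrightarrow> A u = m"

lemma bump_exists:
  obtains B A C m where "bump r B A C m"
proof -
  \<comment> \<open>The exponent \<open>r + 2\<close> makes all derivatives of order at most
    \<open>r + 1\<close> vanish at both endpoints, as the gluing requires.\<close>
  define p :: "real poly" where "p = [:0, 1:] ^ (r + 2) * [:1, -1:] ^ (r + 2)"
  define B :: "nat \<Rightarrow> real \<Rightarrow> real" where "B = (\<lambda>j u. if u \<in> {0..1} then poly ((pderiv ^^ j) p) u else 0)"
  obtain Q where Q: "pderiv Q = p" using pderiv_surj by blast
  define m where "m = poly Q 1 - poly Q 0"
  \<comment> \<open>Off the unit interval the threshold 1/2 merely tells left from right.\<close>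
  define A where "A = (\<lambda>u. if u \<in> {0..1} then poly Q u - poly Q 0 else if u < 1/2 then 0 else m)"
  have root: "poly ((pderiv ^^ j) p) 0 = 0" "poly ((pderiv ^^ j) p) 1 = 0" if "j \<le> Suc r" for j
  proof -
    have "r + 2 = (r + 2 - j) + j" using that by simp
    then have "[:0, 1:] ^ (r + 2 - j) dvd (pderiv ^^ j) p" "[:1, -1:] ^ (r + 2 - j) dvd (pderiv ^^ j) p"
      by (metis p_def power_dvd_pderiv_iterate dvd_triv_left,
          metis p_def power_dvd_pderiv_iterate dvd_triv_right)
    then have "[:0, 1:] dvd (pderiv ^^ j) p" "[:1, -1:] dvd (pderiv ^^ j) p"
      using that by (auto intro: dvd_trans[OF dvd_power[of "r + 2 - j"]])
    then obtain k l where k: "(pderiv ^^ j) p = [:0, 1:] * k" and l: "(pderiv ^^ j) p = [:1, -1:] * l"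
      by (auto elim!: dvdE simp del: mult_pCons_left)
    show "poly ((pderiv ^^ j) p) 0 = 0" unfolding k by simp
    show "poly ((pderiv ^^ j) p) 1 = 0" unfolding l by simp
  qed
  have dB: "(B j has_real_derivative B (Suc j) u) (at u)" if "j \<le> r" for j u
    unfolding B_def
    using root[of j] root[of "Suc j"] that
    by (intro DERIV_glue_unit_interval) (auto intro: poly_DERIV)
  have dA: "(A has_real_derivative B 0 u) (at u)" for u
  proof -
    have g: "((\<lambda>u. if u < 1/2 then 0 else m) has_real_derivative 0) (at u)" if "u \<le> 0 \<or> 1 \<le> u" for u :: real
    proof (cases "u \<le> 0")
      case True
      have "((\<lambda>u. 0) has_real_derivative 0) (at u)" by simp
      then show ?thesis
        by (rule has_field_derivative_transform_within_open[where S = "{..<1/2}"]) (use True in auto)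
    next
      case False
      have "((\<lambda>u. m) has_real_derivative 0) (at u)" by simp
      then show ?thesis
        by (rule has_field_derivative_transform_within_open[where S = "{1/2<..}"]) (use False that in auto)
    qed
    have f: "((\<lambda>u. poly Q u - poly Q 0) has_real_derivative poly p u) (at u)" for u
      using poly_DERIV[of Q u] Q by (auto intro!: derivative_eq_intros)
    show ?thesis
      unfolding A_def B_def funpow_0
      by (rule DERIV_glue_unit_interval) (use f g root[of 0] in \<open>auto simp: m_def\<close>)
  qed
  have zB: "B j u = 0" if "j \<le> Suc r" "u \<le> 0 \<or> 1 \<le> u" for j u
    using that root[of j] by (auto simp: B_def)
  have "\<exists>C. \<forall>u. \<bar>B j u\<bar> \<le> C" for j
  proof -
    have "compact ((\<lambda>u. poly ((pderiv ^^ j) p) u) ` {0..1})"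
      by (intro compact_continuous_image continuous_intros compact_Icc)
    then obtain C where C: "\<forall>y \<in> (\<lambda>u. poly ((pderiv ^^ j) p) u) ` {0..1}. \<bar>y\<bar> \<le> C"
      using compact_imp_bounded bounded_iff by (metis real_norm_def)
    have "\<bar>B j u\<bar> \<le> max C 0" for u using C unfolding B_def by (fastforce simp: le_max_iff_disj)
    then show ?thesis by blast
  qed
  then obtain c where c: "\<And>j u. \<bar>B j u\<bar> \<le> c j" by metis
  define C where "C = 1 + (\<Sum>j\<le>Suc r. c j)"
  have c0: "0 \<le> c j" for j using c[of j 0] by linarith
  have cC: "c j \<le> C - 1" if "j \<le> Suc r" for j
    unfolding C_def using that member_le_sum[of j "{..Suc r}" c] c0 by simp
  have C1: "1 \<le> C" using cC[of 0] c0[of 0] by simp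
  \<comment> \<open>The mass equals the bump value at an interior point, which yields both
    \<open>0 < m\<close> and \<open>m \<le> C\<close> without evaluating the integral.\<close>
  have "\<exists>z. 0 < z \<and> z < 1 \<and> A 1 - A 0 = (1 - 0) * B 0 z"
    by (rule MVT2) (use dA in auto)
  then obtain z where z: "0 < z" "z < 1" "m = B 0 z" by (auto simp: A_def m_def)
  have "B 0 z = z ^ (r + 2) * (1 - z) ^ (r + 2)"
    using z by (simp only: B_def p_def funpow_0 poly_mult poly_power) simp
  then have "0 < m" using z by simp
  have "bump r B A C m"
  proof
    show "m \<le> C" using z(3) c[of 0 z] cC[of 0] by linarith
    show "\<bar>B j u\<bar> \<le> C" if "j \<le> Suc r" for j u using c[of j u] cC[OF that] by linarith
    show "A u = 0" if "u \<le> 0" for u using that by (cases "u = 0") (auto simp: A_def)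
    show "A u = m" if "1 \<le> u" for u using that by (cases "u = 1") (auto simp: A_def m_def)
  qed (fact C1 \<open>0 < m\<close> dA dB zB)+
  then show thesis by (rule that)
qed

section \<open>Perturbations of the uniform density\<close>

text \<open>\<open>dd\<close> picks derivatives by \<open>SOME\<close>; every point of [0, 1] is a
  limit point of it, so derivatives within the interval are unique and any explicit chain of
  derivatives must agree with \<open>dd\<close> there.\<close>

lemma dd_eqI:
  assumes "D 0 = f"
    and "\<And>j x. j < r \<Longrightarrow> x \<in> {0..1} \<Longrightarrow> (D j has_real_derivative D (Suc j) x) (at x within {0..1})"
    and "j \<le> r" "x \<in> {0..1}"
  shows "dd f j x = D j x"
  using assms(3,4)
proof (induction j arbitrary: x)
  case (Suc j)
  have "(dd f j has_real_derivative D (Suc j) x) (at x within {0..1})"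
    using assms(2)[of j x] Suc
    by (auto intro: has_field_derivative_transform_within[where d = 1])
  moreover have "at x within {0..1::real} \<noteq> bot"
    using Suc.prems by (simp add: trivial_limit_within islimpt_Icc)
  ultimately have "(SOME d. (dd f j has_real_derivative d) (at x within {0..1})) = D (Suc j) x"
    by (intro some_equality) (auto intro: has_field_derivative_unique)
  then show ?case by simp
qed (simp add: assms(1))

text \<open>Projection of an output onto an interval containing all medians of the family, which lie
  in [7/16, 1/2]. It tames outputs far from the middle, where the distribution function is no longer
  affine.\<close>

definition clip :: "real \<Rightarrow> real" where
  "clip x = min (9/16) (max (7/16) x)"

text \<open>The amplitude \<delta> is independent of \<open>N\<close>. The bound
  \<open>\<delta> * C \<le> 1/4\<close> keeps the density above 3/4 and, with
  \<open>m \<le> C\<close>, limits the total displacement of the median to 1/16.\<close>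

locale bump_family = bump +
  fixes \<rho> \<delta> :: real and N :: nat
  assumes \<rho>: "0 < \<rho>" "\<rho> \<le> 1" and \<delta>: "0 < \<delta>" "\<delta> * C \<le> 1/4" and N: "1 \<le> N"
begin

definition G :: "nat set \<Rightarrow> nat \<Rightarrow> real \<Rightarrow> real" where
  "G S j u = (\<Sum>i\<in>S. B j (u - real i) - B j (u - real (3 * N + i)))"

text \<open>The positive bumps fill [0, 1/4] and their negative copies fill [3/4, 1], so that total mass
  stays 1 while the distribution function on [1/4, 3/4] is shifted in proportion to \<open>card S\<close>.\<close>

definition fam_deriv :: "nat set \<Rightarrow> nat \<Rightarrow> real \<Rightarrow> real" where
  "fam_deriv S j x = (if j = 0 then 1 else 0)
     + \<delta> * (4 * real N) powr (real j - (r + \<rho>)) * G S j (4 * real N * x)"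

abbreviation fam :: "nat set \<Rightarrow> real \<Rightarrow> real" where
  "fam S \<equiv> fam_deriv S 0"

definition cdf :: "nat set \<Rightarrow> real \<Rightarrow> real" where
  "cdf S x = x + \<delta> * (4 * real N) powr (- (r + \<rho> + 1))
     * (\<Sum>i\<in>S. A (4 * real N * x - real i) - A (4 * real N * x - real (3 * N + i)))"

text \<open>The mass of one scaled bump: height factor
  \<open>\<delta> * (4 * real N) powr (- (r + \<rho>))\<close>, width
  \<open>1 / (4 * real N)\<close>, unscaled mass \<open>m\<close>.\<close>

definition shift :: real where
  "shift = \<delta> * m * (4 * real N) powr (- (r + \<rho> + 1))"

text \<open>The only index whose membership in \<open>S\<close> can influence an evaluation at
  \<open>x\<close>. A bump and its copy share it; the middle region gets the dummy index
  \<open>N\<close>, and so does \<open>x = 1\<close>, where the floor is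
  \<open>4 * N\<close>.\<close>

definition cell :: "real \<Rightarrow> nat" where
  "cell x = (let k = nat \<lfloor>4 * real N * x\<rfloor> in if k < N then k else if 3 * N \<le> k then k - 3 * N else N)"

lemma shift_pos: "0 < shift"
  using \<delta> m_pos N by (simp add: shift_def)

lemma powr_le_1: "t \<le> 0 \<Longrightarrow> (4 * real N) powr t \<le> 1"
  using N powr_mono[of t 0 "4 * real N"] by simp

lemma shift_le: "shift * N \<le> 1/16"
proof -
  have "(4 * real N) powr (- (r + \<rho> + 1)) * (4 * real N) = (4 * real N) powr (- (r + \<rho>))"
    using N by (simp add: powr_diff powr_minus powr_add divide_simps)
  also have "\<dots> \<le> 1" using \<rho> by (intro powr_le_1) auto
  finally have *: "(4 * real N) powr (- (r + \<rho> + 1)) * (4 * real N) \<le> 1" .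
  have "shift * (4 * real N) = (\<delta> * m) * ((4 * real N) powr (- (r + \<rho> + 1)) * (4 * real N))"
    by (simp add: shift_def)
  also have "\<dots> \<le> (\<delta> * m) * 1" using * \<delta> m_pos by (intro mult_left_mono) auto
  also have "\<dots> \<le> 1/4" using \<delta> m_le mult_left_mono[OF m_le, of \<delta>] by linarith
  finally show ?thesis by simp
qed

text \<open>Bumps live on disjoint unit cells, so only the one at the floor of \<open>u\<close>
  survives. The injection \<open>g\<close> lets the lemma treat the originals and the copies
  alike.\<close>

lemma sum_bump:
  assumes "finite S" "0 \<le> u" "j \<le> Suc r" and inj: "inj_on g S"
  shows "(\<Sum>i\<in>S. B j (u - real (g i))) = (if nat \<lfloor>u\<rfloor> \<in> g ` S then B j (u - real (nat \<lfloor>u\<rfloor>)) else 0)"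
proof -
  have z: "B j (u - real n) = 0" if "n \<noteq> nat \<lfloor>u\<rfloor>" for n
  proof -
    have "u - real n \<le> 0 \<or> 1 \<le> u - real n" using that \<open>0 \<le> u\<close> by linarith
    then show ?thesis using B_support assms by blast
  qed
  have "(\<Sum>i\<in>S. B j (u - real (g i))) = (\<Sum>n\<in>g ` S. B j (u - real n))"
    using inj by (simp add: sum.reindex)
  also have "\<dots> = (\<Sum>n\<in>g ` S. if n = nat \<lfloor>u\<rfloor> then B j (u - real (nat \<lfloor>u\<rfloor>)) else 0)"
    using z by (intro sum.cong) auto
  also have "\<dots> = (if nat \<lfloor>u\<rfloor> \<in> g ` S then B j (u - real (nat \<lfloor>u\<rfloor>)) else 0)"
    using assms by (simp add: sum.delta')
  finally show ?thesis .
qed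

lemma G_eq:
  assumes "S \<subseteq> {..<N}" "0 \<le> x" "j \<le> Suc r"
  shows "G S j (4 * real N * x) = (if cell x \<in> S then (if nat \<lfloor>4 * real N * x\<rfloor> < N then 1 else -1)
           * B j (4 * real N * x - real (nat \<lfloor>4 * real N * x\<rfloor>)) else 0)"
proof -
  have fin: "finite S" using assms finite_subset by blast
  define k where "k = nat \<lfloor>4 * real N * x\<rfloor>"
  have "G S j (4 * real N * x) = (if k \<in> S then B j (4 * real N * x - real k) else 0)
      - (if k \<in> (\<lambda>i. 3 * N + i) ` S then B j (4 * real N * x - real k) else 0)"
    unfolding G_def sum_subtractf k_def
    using sum_bump[OF fin _ assms(3), of "4 * real N * x" "\<lambda>i. i"] sum_bump[OF fin _ assms(3), of "4 * real N * x" "\<lambda>i. 3 * N + i"] assms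
    by (simp add: inj_on_def)
  moreover have "k \<in> S \<longleftrightarrow> k < N \<and> cell x \<in> S"
    using assms(1) by (auto simp: cell_def k_def[symmetric] Let_def)
  moreover have "k \<in> (\<lambda>i. 3 * N + i) ` S \<longleftrightarrow> \<not> k < N \<and> cell x \<in> S"
  proof
    assume "k \<in> (\<lambda>i. 3 * N + i) ` S"
    then show "\<not> k < N \<and> cell x \<in> S" using N by (auto simp: cell_def k_def[symmetric] Let_def)
  next
    assume *: "\<not> k < N \<and> cell x \<in> S"
    then have "cell x < N" using assms(1) by auto
    with * have "3 * N \<le> k" "cell x = k - 3 * N"
      by (auto simp: cell_def k_def[symmetric] Let_def split: if_splits)
    with * show "k \<in> (\<lambda>i. 3 * N + i) ` S" by (intro image_eqI[of _ _ "cell x"]) auto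
  qed
  ultimately show ?thesis unfolding k_def[symmetric] by auto
qed

lemma G_le:
  assumes "S \<subseteq> {..<N}" "0 \<le> u" "j \<le> Suc r"
  shows "\<bar>G S j u\<bar> \<le> C"
proof -
  have "u = 4 * real N * (u / (4 * real N))" using N by simp
  then show ?thesis
    using G_eq[OF assms(1) _ assms(3), of "u / (4 * real N)"] B_le[OF assms(3)] assms(2) C_ge_1
    by (auto simp: abs_mult)
qed

lemma DERIV_G:
  assumes "j \<le> r" shows "(G S j has_real_derivative G S (Suc j) u) (at u)"
proof -
  have "((\<lambda>u. B j (u - real n)) has_real_derivative B (Suc j) (u - real n) * 1) (at u)" for n
    by (intro DERIV_chain2[OF DERIV_B[OF assms]] derivative_eq_intros) auto
  then show ?thesis
    unfolding G_def[abs_def] by (intro DERIV_sum DERIV_diff) (simp_all del: of_nat_add)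
qed

lemma DERIV_fam:
  assumes "j \<le> r"
  shows "(fam_deriv S j has_real_derivative fam_deriv S (Suc j) x) (at x)"
proof -
  have "((\<lambda>x. G S j (4 * real N * x)) has_real_derivative G S (Suc j) (4 * real N * x) * (4 * real N)) (at x)"
    by (intro DERIV_chain2[OF DERIV_G[OF assms]] derivative_eq_intros) auto
  moreover have "(4 * real N) powr (real (Suc j) - (r + \<rho>)) = (4 * real N) powr (real j - (r + \<rho>)) * (4 * real N)"
  proof -
    have "real (Suc j) - (r + \<rho>) = (real j - (r + \<rho>)) + 1" by simp
    then show ?thesis using N by (simp only: powr_add) simp
  qed
  ultimately show ?thesis
    unfolding fam_deriv_def by (auto intro!: derivative_eq_intros simp: mult_ac)
qed

lemma DERIV_cdf: "(cdf S has_real_derivative fam S x) (at x)"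
proof -
  have *: "((\<lambda>x. A (4 * real N * x - real n)) has_real_derivative B 0 (4 * real N * x - real n) * (4 * real N)) (at x)" for n
    by (intro DERIV_chain2[OF DERIV_A] derivative_eq_intros) auto
  have **: "((\<lambda>x. \<Sum>i\<in>S. A (4 * real N * x - real i) - A (4 * real N * x - real (3 * N + i)))
      has_real_derivative G S 0 (4 * real N * x) * (4 * real N)) (at x)"
    unfolding G_def sum_distrib_right left_diff_distrib
    by (intro DERIV_sum DERIV_diff *)
  have "(4 * real N) powr (- (r + \<rho> + 1)) * (4 * real N) = (4 * real N) powr (- (r + \<rho>))"
    using N by (simp add: powr_diff powr_minus powr_add divide_simps)
  then have "1 + \<delta> * (4 * real N) powr (- (r + \<rho> + 1)) * (G S 0 (4 * real N * x) * (4 * real N)) = fam S x"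
    by (simp add: fam_deriv_def mult_ac)
  with DERIV_add[OF DERIV_ident DERIV_cmult[OF **, of "\<delta> * (4 * real N) powr (- (r + \<rho> + 1))"]]
  show ?thesis unfolding cdf_def[abs_def] by simp
qed

lemma integral_fam: "0 \<le> x \<Longrightarrow> (fam S has_integral cdf S x) {0..x}"
proof -
  assume "0 \<le> x"
  have "cdf S 0 = 0" by (simp add: cdf_def A_left)
  then show ?thesis
    using fundamental_theorem_of_calculus[OF \<open>0 \<le> x\<close>, of "cdf S" "fam S"] DERIV_cdf[of S]
    by (simp add: has_real_derivative_iff_has_vector_derivative has_vector_derivative_at_within)
qed

text \<open>In this range every positive bump is already complete and no negative one has begun, so
  each index contributes exactly its mass.\<close>

lemma cdf_middle:
  assumes "S \<subseteq> {..<N}" "x \<in> {1/4..3/4}"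
  shows "cdf S x = x + shift * card S"
proof -
  have "(\<Sum>i\<in>S. A (4 * real N * x - real i) - A (4 * real N * x - real (3 * N + i))) = (\<Sum>i\<in>S. m)"
  proof (rule sum.cong)
    fix i assume "i \<in> S"
    then have "real i + 1 \<le> N" using assms by force
    moreover have "real N * 1 \<le> real N * (4 * x)" "real N * (4 * x) \<le> real N * 3"
      using assms(2) by (intro mult_left_mono; simp)+
    moreover have "4 * real N * x = real N * (4 * x)" by simp
    ultimately have "1 \<le> 4 * real N * x - real i" "4 * real N * x - real (3 * N + i) \<le> 0"
      by linarith+
    then show "A (4 * real N * x - real i) - A (4 * real N * x - real (3 * N + i)) = m"
      using A_right A_left by simp
  qed simp
  then show ?thesis by (simp add: cdf_def shift_def mult_ac)
qed

lemma cdf_1: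
  assumes "S \<subseteq> {..<N}" shows "cdf S 1 = 1"
proof -
  have "(\<Sum>i\<in>S. A (4 * real N * 1 - real i) - A (4 * real N * 1 - real (3 * N + i))) = (\<Sum>i\<in>S. 0)"
  proof (rule sum.cong)
    fix i assume "i \<in> S"
    then have "real i + 1 \<le> N" using assms by force
    then show "A (4 * real N * 1 - real i) - A (4 * real N * 1 - real (3 * N + i)) = 0"
      using A_right[of "4 * real N * 1 - real i"] A_right[of "4 * real N * 1 - real (3 * N + i)"] by simp
  qed simp
  then show ?thesis by (simp add: cdf_def)
qed

lemma perturbation_le:
  assumes "S \<subseteq> {..<N}" "0 \<le> x" "j \<le> r"
  shows "\<bar>\<delta> * (4 * real N) powr (real j - (r + \<rho>)) * G S j (4 * real N * x)\<bar> \<le> \<delta> * C"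
proof -
  have "\<bar>\<delta> * (4 * real N) powr (real j - (r + \<rho>)) * G S j (4 * real N * x)\<bar>
      = \<delta> * ((4 * real N) powr (real j - (r + \<rho>)) * \<bar>G S j (4 * real N * x)\<bar>)"
    using \<delta> by (simp add: abs_mult)
  also have "\<dots> \<le> \<delta> * (1 * C)"
    using powr_le_1[of "real j - (r + \<rho>)"] G_le[OF assms(1), of "4 * real N * x" j] assms \<delta> \<rho>
    by (intro mult_left_mono mult_mono) auto
  finally show ?thesis by simp
qed

lemma fam_bounds:
  assumes "S \<subseteq> {..<N}" "0 \<le> x" shows "3/4 \<le> fam S x"
  using perturbation_le[OF assms, of 0] \<delta> by (simp add: fam_deriv_def)

lemma dd_fam: "j \<le> r \<Longrightarrow> x \<in> {0..1} \<Longrightarrow> dd (fam S) j x = fam_deriv S j x"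
  by (rule dd_eqI[where D = "fam_deriv S" and r = r])
     (use DERIV_fam in \<open>simp_all add: has_field_derivative_at_within\<close>)

lemma dd_fam_local:
  assumes "S \<subseteq> {..<N}" "T \<subseteq> {..<N}" "j \<le> r" "x \<in> {0..1}" "cell x \<in> S \<longleftrightarrow> cell x \<in> T"
  shows "dd (fam S) j x = dd (fam T) j x"
  using assms by (simp add: dd_fam fam_deriv_def G_eq)

text \<open>At distance at most 1 the Lipschitz bound is used together with
  \<open>t \<le> t powr \<rho>\<close>; at larger distance the supremum bound suffices and gives the
  factor 2. As the supports are disjoint, the constant does not grow with
  \<open>card S\<close>.\<close>

lemma G_Holder:
  assumes "S \<subseteq> {..<N}" "0 \<le> u" "0 \<le> v"
  shows "\<bar>G S r u - G S r v\<bar> \<le> 2 * C * \<bar>u - v\<bar> powr \<rho>"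
proof (cases "\<bar>u - v\<bar> \<le> 1")
  case True
  have "\<bar>G S r u - G S r v\<bar> \<le> C * \<bar>u - v\<bar>"
    using field_differentiable_bound[of "{0..}" "G S r" "G S (Suc r)" C u v]
      DERIV_G[of r S] G_le[OF assms(1), of _ "Suc r"] assms
    by (auto intro: has_field_derivative_at_within)
  also have "C * \<bar>u - v\<bar> \<le> 2 * C * \<bar>u - v\<bar> powr \<rho>"
  proof -
    have "\<bar>u - v\<bar> \<le> \<bar>u - v\<bar> powr \<rho>"
    proof (cases "u = v")
      case False
      then show ?thesis using powr_mono'[of \<rho> 1 "\<bar>u - v\<bar>"] True \<rho> by simp
    qed simp
    then show ?thesis using C_ge_1 by (intro mult_mono) auto
  qed
  finally show ?thesis .
next
  case False
  have "\<bar>G S r u - G S r v\<bar> \<le> 2 * C"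
    using G_le[OF assms(1,2), of r] G_le[OF assms(1,3), of r] by linarith
  also have "\<dots> \<le> 2 * C * \<bar>u - v\<bar> powr \<rho>"
    using False ge_one_powr_ge_zero[of "\<bar>u - v\<bar>" \<rho>] \<rho> C_ge_1 by simp
  finally show ?thesis .
qed

text \<open>At order \<open>r\<close> the amplitude factor
  \<open>(4 * real N) powr (- \<rho>)\<close> cancels the factor
  \<open>(4 * real N) powr \<rho>\<close> produced by the dilation, so the requirements on \<delta>
  are uniform in \<open>N\<close>. The bound \<open>D - 1\<close> is the room left above the
  constant density 1.\<close>

lemma fam_in_class:
  assumes "S \<subseteq> {..<N}" "\<delta> * C \<le> D - 1" "\<delta> * (2 * C) \<le> H" "\<gamma> \<le> 2/3"
  shows "fam S \<in> Fdens_low r \<rho> D H \<gamma>"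
proof -
  have "(dd (fam S) j has_real_derivative dd (fam S) (Suc j) x) (at x within {0..1})"
    if "j < r" "x \<in> {0..1}" for j x
  proof -
    have "(fam_deriv S j has_real_derivative dd (fam S) (Suc j) x) (at x within {0..1})"
      using that DERIV_fam[of j S x] by (simp add: dd_fam has_field_derivative_at_within del: dd.simps)
    then show ?thesis
      by (rule has_field_derivative_transform_within[where d = 1]) (use that in \<open>auto simp: dd_fam\<close>)
  qed
  moreover have "continuous_on {0..1} (dd (fam S) r)"
  proof -
    have "continuous_on {0..1} (fam_deriv S r)"
      by (intro DERIV_continuous_on[of _ _ "fam_deriv S (Suc r)"])
         (auto intro: has_field_derivative_at_within DERIV_fam)
    moreover have "dd (fam S) r x = fam_deriv S r x" if "x \<in> {0..1}" for x
      using that by (simp add: dd_fam)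
    ultimately show ?thesis using continuous_on_cong[of "{0..1}" "{0..1}" "dd (fam S) r" "fam_deriv S r"] by blast
  qed
  moreover have "\<bar>dd (fam S) i x\<bar> \<le> D" if "i \<le> r" "x \<in> {0..1}" for i x
    using perturbation_le[OF assms(1), of x i] that assms(2) by (auto simp: dd_fam fam_deriv_def)
  moreover have "\<bar>dd (fam S) r x - dd (fam S) r y\<bar> \<le> H * \<bar>x - y\<bar> powr \<rho>"
    if "x \<in> {0..1}" "y \<in> {0..1}" for x y
  proof -
    have "\<bar>dd (fam S) r x - dd (fam S) r y\<bar>
        = \<bar>\<delta> * (4 * real N) powr (- \<rho>) * (G S r (4 * real N * x) - G S r (4 * real N * y))\<bar>"
      using that by (simp add: dd_fam fam_deriv_def right_diff_distrib)
    also have "\<dots> = \<delta> * (4 * real N) powr (- \<rho>) * \<bar>G S r (4 * real N * x) - G S r (4 * real N * y)\<bar>"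
      using \<delta> by (simp add: abs_mult)
    also have "\<dots> \<le> \<delta> * (4 * real N) powr (- \<rho>) * (2 * C * \<bar>4 * real N * x - 4 * real N * y\<bar> powr \<rho>)"
      using G_Holder[OF assms(1), of "4 * real N * x" "4 * real N * y"] that \<delta> by (intro mult_left_mono) auto
    also have "\<bar>4 * real N * x - 4 * real N * y\<bar> powr \<rho> = (4 * real N) powr \<rho> * \<bar>x - y\<bar> powr \<rho>"
    proof -
      have "\<bar>4 * real N * x - 4 * real N * y\<bar> = 4 * real N * \<bar>x - y\<bar>"
        by (simp flip: right_diff_distrib add: abs_mult)
      then show ?thesis by (simp add: powr_mult)
    qed
    also have "\<delta> * (4 * real N) powr (- \<rho>) * (2 * C * ((4 * real N) powr \<rho> * \<bar>x - y\<bar> powr \<rho>))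
        = \<delta> * (2 * C) * ((4 * real N) powr (- \<rho>) * (4 * real N) powr \<rho>) * \<bar>x - y\<bar> powr \<rho>"
      by (simp add: mult_ac)
    also have "(4 * real N) powr (- \<rho>) * (4 * real N) powr \<rho> = 1"
      using N by (simp flip: powr_add)
    also have "\<delta> * (2 * C) * 1 * \<bar>x - y\<bar> powr \<rho> \<le> H * \<bar>x - y\<bar> powr \<rho>"
      using assms(3) by (intro mult_right_mono) auto
    finally show ?thesis .
  qed
  moreover have "integral {0..1} (fam S) = 1"
    using integral_unique[OF integral_fam[of 1 S]] cdf_1[OF assms(1)] by simp
  moreover have "0 \<le> fam S x" "\<gamma> \<le> fam S x" if "x \<in> {0..1}" for x
    using fam_bounds[OF assms(1), of x] that assms(4) by auto
  ultimately show ?thesis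
    unfolding Fdens_low_def Fdens_def Fclass_def by blast
qed

lemma cdf_strict_mono:
  assumes "S \<subseteq> {..<N}" "0 \<le> x" "x < y" shows "cdf S x < cdf S y"
proof (rule DERIV_pos_imp_increasing[OF \<open>x < y\<close>])
  fix t assume "x \<le> t" "t \<le> y"
  then show "\<exists>d. DERIV (cdf S) t :> d \<and> 0 < d"
    using DERIV_cdf[of S t] fam_bounds[OF assms(1), of t] assms by force
qed

lemma shift_card:
  assumes "S \<subseteq> {..<N}" shows "0 \<le> shift * card S" "shift * card S \<le> 1/16"
proof -
  have "card S \<le> N" using card_mono[OF _ assms] by simp
  then have "shift * card S \<le> shift * N" using shift_pos by (intro mult_left_mono) auto
  then show "shift * card S \<le> 1/16" using shift_le by simp
qed (use shift_pos in simp)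

lemma median_fam:
  assumes "S \<subseteq> {..<N}" shows "median (fam S) = 1/2 - shift * card S"
  unfolding median_def
proof (rule the_equality)
  have "integral {0..x} (fam S) = cdf S x" if "0 \<le> x" for x
    using integral_unique[OF integral_fam[OF that]] .
  moreover have *: "cdf S (1/2 - shift * card S) = 1/2"
    using cdf_middle[OF assms, of "1/2 - shift * card S"] shift_card[OF assms] by simp
  ultimately show "1/2 - shift * card S \<in> {0..1} \<and> integral {0..1/2 - shift * card S} (fam S) = 1/2"
    using shift_card[OF assms] by simp
  fix x assume x: "x \<in> {0..1} \<and> integral {0..x} (fam S) = 1/2"
  then have "cdf S x = 1/2" using integral_unique[OF integral_fam[of x S]] by simp
  then show "x = 1/2 - shift * card S"
    using * cdf_strict_mono[OF assms, of x "1/2 - shift * card S"]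
      cdf_strict_mono[OF assms, of "1/2 - shift * card S" x] shift_card[OF assms] x
    by (cases x "1/2 - shift * card S" rule: linorder_cases) auto
qed

text \<open>The median lies in the interval onto which \<open>clip\<close> projects, so clipping
  cannot increase the distance to it.\<close>

lemma err_abs_fam:
  assumes "S \<subseteq> {..<N}"
  shows "\<bar>clip x - (1/2 - shift * card S)\<bar> \<le> err_abs (fam S) x"
  using shift_card[OF assms] by (auto simp: err_abs_def median_fam[OF assms] clip_def)

text \<open>On [1/4, 3/4] the distribution function has slope 1, so the residual is the distance to
  the median. Outside, monotonicity forces a residual of at least 3/16 on the left and 1/4 on the
  right, while the clipped distance is at most 1/16 and 1/8 respectively.\<close>

lemma err_res_fam:
  assumes "S \<subseteq> {..<N}" "x \<in> {0..1}"
  shows "\<bar>clip x - (1/2 - shift * card S)\<bar> \<le> err_res (fam S) x"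
proof -
  have *: "err_res (fam S) x = \<bar>cdf S x - 1/2\<bar>"
    using integral_unique[OF integral_fam[of x S]] assms by (simp add: err_res_def)
  consider "x < 1/4" | "x \<in> {1/4..3/4}" | "3/4 < x" by fastforce
  then show ?thesis
  proof cases
    case 1
    then have "cdf S x < cdf S (1/4)" using cdf_strict_mono assms by simp
    then show ?thesis using * cdf_middle[OF assms(1), of "1/4"] shift_card[OF assms(1)] 1 by (auto simp: clip_def)
  next
    case 2
    then show ?thesis using * cdf_middle[OF assms(1), of x] shift_card[OF assms(1)] by (auto simp: clip_def)
  next
    case 3
    then have "cdf S (3/4) < cdf S x" using cdf_strict_mono assms by simp
    then show ?thesis using * cdf_middle[OF assms(1), of "3/4"] shift_card[OF assms(1)] 3 by (auto simp: clip_def)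
  qed
qed

end

section \<open>Deterministic and randomized algorithms\<close>

definition flip :: "nat \<Rightarrow> nat set \<Rightarrow> nat set" where
  "flip i S = (if i \<in> S then S - {i} else insert i S)"

definition sign :: "nat \<Rightarrow> nat set \<Rightarrow> real" where
  "sign i S = (if i \<in> S then 1 else -1)"

lemma flip_flip [simp]: "flip i (flip i S) = S"
  by (auto simp: flip_def)

lemma sign_flip: "sign j (flip i S) = (if i = j then - sign j S else sign j S)"
  by (auto simp: sign_def flip_def)

lemma flip_subset: "i < N \<Longrightarrow> S \<subseteq> {..<N} \<Longrightarrow> flip i S \<subseteq> {..<N}"
  by (auto simp: flip_def)

lemma card_eq_sum_sign:
  assumes "S \<subseteq> {..<N}"
  shows "real (card S) = real N / 2 + (\<Sum>i<N. sign i S) / 2"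
proof -
  have "(\<Sum>i<N. sign i S) = (\<Sum>i<N. 2 * of_bool (i \<in> S) - 1)"
    by (intro sum.cong) (auto simp: sign_def)
  also have "\<dots> = 2 * (\<Sum>i<N. of_bool (i \<in> S)) - real N"
    by (simp add: sum_subtractf sum_distrib_left)
  also have "(\<Sum>i<N. of_bool (i \<in> S)) = real (card S)"
    using assms by (simp add: of_bool_def sum.If_cases Int_absorb1 Collect_mem_eq)
  finally show ?thesis by (simp add: field_simps)
qed

text \<open>Flipping \<open>i\<close> is an involution on the subsets that negates every
  summand.\<close>

lemma sum_sign_flip_invariant:
  fixes g :: "nat set \<Rightarrow> real"
  assumes "i < N" "\<And>S. S \<subseteq> {..<N} \<Longrightarrow> g (flip i S) = g S"
  shows "(\<Sum>S\<in>Pow {..<N}. sign i S * g S) = 0"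
proof -
  have "(\<Sum>S\<in>Pow {..<N}. sign i S * g S) = (\<Sum>S\<in>Pow {..<N}. sign i (flip i S) * g (flip i S))"
    using assms(1) by (intro sum.reindex_bij_witness[of _ "flip i" "flip i"]) (simp_all add: flip_subset)
  also have "\<dots> = - (\<Sum>S\<in>Pow {..<N}. sign i S * g S)"
    unfolding sum_negf[symmetric] using assms(2) by (intro sum.cong) (auto simp: sign_flip)
  finally show ?thesis by simp
qed

text \<open>Given what was seen, the unvisited signs are still independent, so each of them
  contributes its full variance to the squared error of an estimate of \<open>card S\<close>.\<close>

lemma sum_square_error_ge:
  fixes a v :: real and z :: "nat set \<Rightarrow> real" and V :: "nat set \<Rightarrow> nat set"
  assumes inv: "\<And>S i. S \<subseteq> {..<N} \<Longrightarrow> i < N \<Longrightarrow> i \<notin> V S \<Longrightarrow> V (flip i S) = V S \<and> z (flip i S) = z S"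
  shows "(\<Sum>S\<in>Pow {..<N}. a\<^sup>2 / 4 * real (card ({..<N} - V S)))
       \<le> (\<Sum>S\<in>Pow {..<N}. (z S - (v - a * card S))\<^sup>2)"
proof -
  \<comment> \<open>The error splits as \<open>W S + U S\<close>: \<open>W\<close> is determined by
    what the algorithm has seen, \<open>U\<close> collects the signs of the unvisited
    indices.\<close>
  define W where "W S = z S - v + a * N / 2 + a / 2 * (\<Sum>i\<in>{..<N} \<inter> V S. sign i S)" for S
  define U where "U S = a / 2 * (\<Sum>i\<in>{..<N} - V S. sign i S)" for S
  \<comment> \<open>\<open>g i S\<close> is the cofactor of \<open>sign i S\<close> in
    \<open>U S * (2 * W S + U S)\<close> once the diagonal term \<open>a\<^sup>2 / 4\<close> has
    been split off. Setting it to 0 on visited indices lets the sum run over all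
    \<open>i < N\<close>, independently of \<open>S\<close>.\<close>
  define g where "g i S = (if i \<in> V S then 0
      else a / 2 * (2 * W S + a / 2 * (\<Sum>j\<in>{..<N} - V S - {i}. sign j S)))" for i S
  \<comment> \<open>This holds for visited \<open>i\<close> too: if \<open>i\<close> were unvisited
    for either of the two sets, \<open>inv\<close> would equate their sets \<open>V\<close>.\<close>
  have flip_V: "i \<in> V (flip i S) \<longleftrightarrow> i \<in> V S" if "S \<subseteq> {..<N}" "i < N" for i S
    using inv[OF that] inv[OF flip_subset[OF that(2,1)] that(2)] by (metis flip_flip)
  have g_flip: "g i (flip i S) = g i S" if S: "S \<subseteq> {..<N}" and i: "i < N" for i S
  proof (cases "i \<in> V S")
    case True
    then show ?thesis using flip_V[OF S i] by (simp add: g_def)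
  next
    case False
    have e: "V (flip i S) = V S" "z (flip i S) = z S" using inv[OF S i False] by auto
    have "(\<Sum>j\<in>{..<N} - V S - {i}. sign j (flip i S)) = (\<Sum>j\<in>{..<N} - V S - {i}. sign j S)"
      by (intro sum.cong) (auto simp: sign_flip)
    moreover have "(\<Sum>j\<in>{..<N} \<inter> V S. sign j (flip i S)) = (\<Sum>j\<in>{..<N} \<inter> V S. sign j S)"
      using False by (intro sum.cong) (auto simp: sign_flip)
    ultimately show ?thesis using False by (simp add: g_def W_def e)
  qed
  have expand: "(z S - (v - a * card S))\<^sup>2
      = (W S)\<^sup>2 + (\<Sum>i<N. sign i S * g i S) + a\<^sup>2 / 4 * real (card ({..<N} - V S))"
    if S: "S \<subseteq> {..<N}" for S
  proof -
    have "(\<Sum>i<N. sign i S) = (\<Sum>i\<in>{..<N} \<inter> V S. sign i S) + (\<Sum>i\<in>{..<N} - V S. sign i S)"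
      by (rule sum.Int_Diff) simp
    then have "z S - (v - a * card S) = W S + U S"
      unfolding card_eq_sum_sign[OF S] W_def U_def by (simp add: algebra_simps add_divide_distrib)
    then have "(z S - (v - a * card S))\<^sup>2 = (W S)\<^sup>2 + U S * (2 * W S + U S)"
      by (simp add: power2_eq_square algebra_simps)
    also have "U S * (2 * W S + U S) = (\<Sum>i\<in>{..<N} - V S. a / 2 * sign i S * (2 * W S + U S))"
      by (simp add: U_def sum_distrib_left sum_distrib_right)
    also have "\<dots> = (\<Sum>i\<in>{..<N} - V S. sign i S * g i S + a\<^sup>2 / 4)"
    proof (rule sum.cong)
      fix i assume i: "i \<in> {..<N} - V S"
      then have "U S = a / 2 * sign i S + a / 2 * (\<Sum>j\<in>{..<N} - V S - {i}. sign j S)"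
        unfolding U_def by (subst sum.remove[of _ i]) (auto simp: algebra_simps)
      moreover have "sign i S * sign i S = 1" by (simp add: sign_def)
      ultimately show "a / 2 * sign i S * (2 * W S + U S) = sign i S * g i S + a\<^sup>2 / 4"
        using i by (simp add: g_def power2_eq_square algebra_simps)
    qed simp
    also have "\<dots> = (\<Sum>i\<in>{..<N} - V S. sign i S * g i S) + a\<^sup>2 / 4 * real (card ({..<N} - V S))"
      by (simp add: sum.distrib)
    also have "(\<Sum>i\<in>{..<N} - V S. sign i S * g i S) = (\<Sum>i<N. sign i S * g i S)"
      by (intro sum.mono_neutral_left) (auto simp: g_def)
    finally show ?thesis by simp
  qed
  have "(\<Sum>S\<in>Pow {..<N}. \<Sum>i<N. sign i S * g i S) = 0"
    by (subst sum.swap) (simp add: sum_sign_flip_invariant g_flip)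
  moreover have "(\<Sum>S\<in>Pow {..<N}. (z S - (v - a * card S))\<^sup>2)
      = (\<Sum>S\<in>Pow {..<N}. (W S)\<^sup>2 + (\<Sum>i<N. sign i S * g i S) + a\<^sup>2 / 4 * real (card ({..<N} - V S)))"
    by (intro sum.cong refl expand) simp
  moreover have "0 \<le> (\<Sum>S\<in>Pow {..<N}. (W S)\<^sup>2)" by (intro sum_nonneg) simp
  ultimately show ?thesis by (simp add: sum.distrib)
qed

text \<open>All that the lower bounds use: an oracle for the bits of \<open>S\<close>, read one at a
  time through \<open>loc\<close>, and an error that controls the estimation of
  \<open>card S\<close>. Stating \<open>err_ge\<close> with the explicit function
  \<open>clip\<close> serves both criteria and keeps the integrands of the randomized case
  measurable without conditions on \<open>e\<close>.\<close>

locale hard_family =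
  fixes r N :: nat and a :: real and f :: "nat set \<Rightarrow> real \<Rightarrow> real"
    and F :: "(real \<Rightarrow> real) set" and e :: "(real \<Rightarrow> real) \<Rightarrow> real \<Rightarrow> real" and loc :: "real \<Rightarrow> nat"
  assumes a_pos: "0 < a"
    and f_in_F: "S \<subseteq> {..<N} \<Longrightarrow> f S \<in> F"
    and dd_local: "S \<subseteq> {..<N} \<Longrightarrow> T \<subseteq> {..<N} \<Longrightarrow> j \<le> r \<Longrightarrow> x \<in> {0..1} \<Longrightarrow> (loc x \<in> S \<longleftrightarrow> loc x \<in> T)
          \<Longrightarrow> dd (f S) j x = dd (f T) j x"
    and err_ge: "S \<subseteq> {..<N} \<Longrightarrow> x \<in> {0..1} \<Longrightarrow> \<bar>clip x - (1/2 - a * card S)\<bar> \<le> e (f S) x"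
begin

definition halts :: "detalg \<Rightarrow> nat set \<Rightarrow> bool" where
  "halts A S = (\<exists>k. stop A (info A (f S) k))"

definition runtime :: "detalg \<Rightarrow> nat set \<Rightarrow> nat" where
  "runtime A S = (LEAST k. stop A (info A (f S) k))"

definition visited :: "detalg \<Rightarrow> nat set \<Rightarrow> nat set" where
  "visited A S = (\<lambda>k. loc (fst (query A (info A (f S) k)))) ` {..<runtime A S}"

lemma dcost_eq: "dcost A (f S) = (if halts A S then enat (runtime A S) else \<infinity>)"
  by (simp add: dcost_def halts_def runtime_def)

lemma card_unvisited: "real N \<le> real (card ({..<N} - visited A S)) + real (runtime A S)"
proof -
  have "card (visited A S) \<le> runtime A S"
    unfolding visited_def using card_image_le[of "{..<runtime A S}"] by simp
  moreover have "N - card (visited A S) \<le> card ({..<N} - visited A S)"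
    using diff_card_le_card_Diff[of "visited A S" "{..<N}"] by (simp add: visited_def)
  ultimately show ?thesis by linarith
qed

text \<open>The next query depends only on the answers so far, so by induction the transcripts never
  diverge. Only the indices visited on \<open>S\<close> enter the hypothesis; that \<open>T\<close>
  visits the same ones is part of the conclusion.\<close>

lemma run_cong:
  assumes A: "det_adm r A" and S: "S \<subseteq> {..<N}" "T \<subseteq> {..<N}" and "halts A S"
    and agree: "S \<inter> visited A S = T \<inter> visited A S"
  shows "halts A T \<and> runtime A T = runtime A S \<and> visited A T = visited A S \<and> dout A (f T) = dout A (f S)"
proof -
  have info_eq: "k \<le> runtime A S \<Longrightarrow> info A (f T) k = info A (f S) k" for k
  proof (induction k)
    case (Suc k)
    obtain x j where q: "query A (info A (f S) k) = (x, j)" by fastforce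
    then have "loc x \<in> visited A S"
      using Suc.prems unfolding visited_def by (intro image_eqI[of _ _ k]) auto
    then have "loc x \<in> T \<longleftrightarrow> loc x \<in> S" using agree by auto
    moreover have "j \<le> r" "x \<in> {0..1}" using A q by (auto simp: det_adm_def dest: spec[of _ "info A (f S) k"])
    ultimately have "dd (f T) j x = dd (f S) j x" using dd_local S by blast
    then show ?case using Suc q by simp
  qed simp
  have st: "stop A (info A (f S) (runtime A S))"
    using \<open>halts A S\<close> unfolding halts_def runtime_def by (rule LeastI_ex)
  have rt: "runtime A T = runtime A S"
    unfolding runtime_def[of A T]
  proof (rule Least_equality)
    show "stop A (info A (f T) (runtime A S))" using st info_eq by simp
    show "runtime A S \<le> y" if "stop A (info A (f T) y)" for y
    proof (rule ccontr)
      assume "\<not> runtime A S \<le> y"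
      then have "stop A (info A (f S) y)" "y < runtime A S" using that info_eq[of y] by auto
      then show False unfolding runtime_def using not_less_Least by blast
    qed
  qed
  moreover have "halts A T" unfolding halts_def using st info_eq[of "runtime A S"] by (intro exI[of _ "runtime A S"]) simp
  moreover have "visited A T = visited A S"
    unfolding visited_def rt using info_eq by (intro image_cong) auto
  moreover have "dout A (f T) = dout A (f S)"
    using rt info_eq unfolding dout_def runtime_def by simp
  ultimately show ?thesis by simp
qed

lemma dout_unit: "det_adm r A \<Longrightarrow> dout A g \<in> {0..1}"
  by (simp add: det_adm_def dout_def)

text \<open>Adversary argument: the full set and its visited part \<open>T\<close> produce the same
  output, so the two true values differ by at most \<open>2 * \<epsilon> \<le> a * N / 2\<close>,
  which forces \<open>T\<close> to contain at least half of the indices.\<close>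

theorem comp_det_ge:
  assumes "4 * \<epsilon> \<le> a * N"
  shows "ennreal (N / 2) \<le> comp_det r F e \<epsilon>"
  unfolding comp_det_def
proof (rule INF_greatest)
  fix A assume "A \<in> {A. det_adm r A \<and> (\<forall>f\<in>F. e f (dout A f) \<le> \<epsilon>)}"
  then have A: "det_adm r A" and err: "\<And>g. g \<in> F \<Longrightarrow> e g (dout A g) \<le> \<epsilon>" by auto
  have "ennreal (N / 2) \<le> ennreal_of_enat (dcost A (f {..<N}))"
  proof (cases "halts A {..<N}")
    case True
    define T where "T = {..<N} \<inter> visited A {..<N}"
    have T: "T \<subseteq> {..<N}" by (auto simp: T_def)
    have "dout A (f T) = dout A (f {..<N})"
      using run_cong[OF A _ T True] by (auto simp: T_def)
    then have "\<bar>clip (dout A (f {..<N})) - (1/2 - a * card T)\<bar> \<le> \<epsilon>"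
      "\<bar>clip (dout A (f {..<N})) - (1/2 - a * N)\<bar> \<le> \<epsilon>"
      using err_ge[OF T dout_unit[OF A, of "f T"]] err_ge[OF _ dout_unit[OF A, of "f {..<N}"], of "{..<N}"]
        err[OF f_in_F[OF T]] err[OF f_in_F[of "{..<N}"]] by auto
    then have "a * N \<le> a * card T + 2 * \<epsilon>" by linarith
    also have "\<dots> \<le> a * card T + a * N / 2" using assms by simp
    finally have "a * (real N / 2) \<le> a * real (card T)" by simp
    then have "real N / 2 \<le> card T" using a_pos by simp
    also have "card T \<le> card (visited A {..<N})" by (rule card_mono) (auto simp: T_def visited_def)
    also have "\<dots> \<le> runtime A {..<N}"
      unfolding visited_def using card_image_le[of "{..<runtime A {..<N}}"] by simp
    finally show ?thesis
      using True by (simp add: dcost_eq ennreal_leI flip: ennreal_of_nat_eq_real_of_nat)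
  qed (simp add: dcost_eq)
  also have "\<dots> \<le> (SUP f\<in>F. ennreal_of_enat (dcost A f))"
    by (rule SUP_upper) (simp add: f_in_F)
  finally show "ennreal (N / 2) \<le> (SUP f\<in>F. ennreal_of_enat (dcost A f))" .
qed

text \<open>Each query is priced at \<open>a\<^sup>2 / 4\<close>, the variance of one bit that it
  may remove. Error and cost enter linearly, so the inequality can be integrated over the random
  element with no truncation of long runs. A run that does not halt makes the right side
  infinite.\<close>

lemma square_error_plus_cost_ge:
  assumes A: "det_adm r A"
  shows "(\<Sum>S\<in>Pow {..<N}. ennreal (a\<^sup>2 / 4 * N))
     \<le> (\<Sum>S\<in>Pow {..<N}. ennreal ((clip (dout A (f S)) - (1/2 - a * card S))\<^sup>2)
          + ennreal (a\<^sup>2 / 4) * ennreal_of_enat (dcost A (f S)))"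
proof (cases "\<forall>S\<in>Pow {..<N}. halts A S")
  case True
  have inv: "visited A (flip i S) = visited A S \<and> clip (dout A (f (flip i S))) = clip (dout A (f S))"
    if "S \<subseteq> {..<N}" "i < N" "i \<notin> visited A S" for S i
  proof -
    have agree: "S \<inter> visited A S = flip i S \<inter> visited A S" using that(3) by (auto simp: flip_def)
    have "halts A S" using True that(1) by blast
    from run_cong[OF A that(1) flip_subset[OF that(2,1)] this agree] show ?thesis by simp
  qed
  have *: "(\<Sum>S\<in>Pow {..<N}. a\<^sup>2 / 4 * real (card ({..<N} - visited A S)))
      \<le> (\<Sum>S\<in>Pow {..<N}. (clip (dout A (f S)) - (1/2 - a * card S))\<^sup>2)"
    by (rule sum_square_error_ge[where V = "visited A" and z = "\<lambda>S. clip (dout A (f S))" and v = "1/2"])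
       (rule inv)
  have "(\<Sum>S\<in>Pow {..<N}. a\<^sup>2 / 4 * N)
      \<le> (\<Sum>S\<in>Pow {..<N}. a\<^sup>2 / 4 * real (card ({..<N} - visited A S)) + a\<^sup>2 / 4 * runtime A S)"
    unfolding distrib_left[symmetric] by (intro sum_mono mult_left_mono card_unvisited) simp
  also have "\<dots> \<le> (\<Sum>S\<in>Pow {..<N}. (clip (dout A (f S)) - (1/2 - a * card S))\<^sup>2 + a\<^sup>2 / 4 * runtime A S)"
    using * by (simp add: sum.distrib)
  finally have "ennreal (\<Sum>S\<in>Pow {..<N}. a\<^sup>2 / 4 * N)
      \<le> ennreal (\<Sum>S\<in>Pow {..<N}. (clip (dout A (f S)) - (1/2 - a * card S))\<^sup>2 + a\<^sup>2 / 4 * runtime A S)"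
    by (rule ennreal_leI)
  also have "\<dots> = (\<Sum>S\<in>Pow {..<N}. ennreal ((clip (dout A (f S)) - (1/2 - a * card S))\<^sup>2)
          + ennreal (a\<^sup>2 / 4) * ennreal_of_enat (dcost A (f S)))"
    using True by (subst sum_ennreal[symmetric])
      (auto intro!: sum.cong simp: dcost_eq ennreal_of_nat_eq_real_of_nat ennreal_mult[symmetric]
          ennreal_plus[symmetric] simp del: ennreal_plus)
  finally show ?thesis by (subst sum_ennreal) auto
next
  case False
  then obtain S where S: "S \<in> Pow {..<N}" "\<not> halts A S" by blast
  then have "ennreal ((clip (dout A (f S)) - (1/2 - a * card S))\<^sup>2)
      + ennreal (a\<^sup>2 / 4) * ennreal_of_enat (dcost A (f S)) = \<top>"
    using a_pos by (simp add: dcost_eq ennreal_mult_eq_top_iff)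
  with S(1) have "(\<Sum>S\<in>Pow {..<N}. ennreal ((clip (dout A (f S)) - (1/2 - a * card S))\<^sup>2)
      + ennreal (a\<^sup>2 / 4) * ennreal_of_enat (dcost A (f S))) = \<top>"
    by (subst ennreal_sum_eq_top) auto
  then show ?thesis by (simp only: top_greatest)
qed

text \<open>Averaging over the uniform distribution on subsets reduces the claim to deterministic
  algorithms. After cancelling \<open>2 ^ N\<close> there remains
  \<open>a\<^sup>2 * N \<le> 4 * \<epsilon>\<^sup>2 + a\<^sup>2 * c\<close> for the cost
  \<open>c\<close>, and the hypothesis bounds the first term on the right by half of the left
  side.\<close>

theorem comp_rand_ge:
  assumes "8 * \<epsilon>\<^sup>2 \<le> a\<^sup>2 * N"
  shows "ennreal (N / 2) \<le> comp_rand TYPE('w) r F e \<epsilon>"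
  unfolding comp_rand_def
proof (rule INF_greatest, clarify)
  fix M :: "'w measure" and A :: "'w \<Rightarrow> detalg"
  assume adm: "rand_adm r F M A"
    and err: "\<forall>f\<in>F. (\<integral>\<^sup>+\<omega>. ennreal ((e f (dout (A \<omega>) f))\<^sup>2) \<partial>M) \<le> ennreal (\<epsilon>\<^sup>2)"
  interpret prob_space M using adm by (simp add: rand_adm_def)
  have A: "det_adm r (A \<omega>)" if "\<omega> \<in> space M" for \<omega> using adm that by (simp add: rand_adm_def)
  let ?err = "\<lambda>S \<omega>. ennreal ((clip (dout (A \<omega>) (f S)) - (1/2 - a * card S))\<^sup>2)"
  let ?cost = "\<lambda>S \<omega>. ennreal_of_enat (dcost (A \<omega>) (f S))"
  have meas: "?err S \<in> borel_measurable M" "?cost S \<in> borel_measurable M" if "S \<subseteq> {..<N}" for S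
  proof -
    have [measurable]: "(\<lambda>\<omega>. dout (A \<omega>) (f S)) \<in> borel_measurable M"
      and c: "(\<lambda>\<omega>. dcost (A \<omega>) (f S)) \<in> measurable M (count_space UNIV)"
      using adm f_in_F[OF that] by (auto simp: rand_adm_def)
    show "?err S \<in> borel_measurable M" unfolding clip_def by measurable
    show "?cost S \<in> borel_measurable M" by (rule measurable_compose[OF c]) simp
  qed
  have err_le: "(\<integral>\<^sup>+\<omega>. ?err S \<omega> \<partial>M) \<le> ennreal (\<epsilon>\<^sup>2)" if "S \<subseteq> {..<N}" for S
  proof -
    have "(\<integral>\<^sup>+\<omega>. ?err S \<omega> \<partial>M) \<le> (\<integral>\<^sup>+\<omega>. ennreal ((e (f S) (dout (A \<omega>) (f S)))\<^sup>2) \<partial>M)"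
    proof (intro nn_integral_mono ennreal_leI)
      fix \<omega> assume "\<omega> \<in> space M"
      from err_ge[OF that dout_unit[OF A[OF this]], of "f S"]
      show "(clip (dout (A \<omega>) (f S)) - (1/2 - a * card S))\<^sup>2 \<le> (e (f S) (dout (A \<omega>) (f S)))\<^sup>2"
        by (intro abs_le_square_iff[THEN iffD1]) linarith
    qed
    also have "\<dots> \<le> ennreal (\<epsilon>\<^sup>2)" using err f_in_F[OF that] by blast
    finally show ?thesis .
  qed
  have cost_le: "(\<integral>\<^sup>+\<omega>. ?cost S \<omega> \<partial>M) \<le> rcost F M A" if "S \<subseteq> {..<N}" for S
    unfolding rcost_def using f_in_F[OF that] by (rule SUP_upper)
  have "(\<Sum>S\<in>Pow {..<N}. ennreal (a\<^sup>2 / 4 * N)) = (\<integral>\<^sup>+\<omega>. (\<Sum>S\<in>Pow {..<N}. ennreal (a\<^sup>2 / 4 * N)) \<partial>M)"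
    by (simp add: emeasure_space_1)
  also have "\<dots> \<le> (\<integral>\<^sup>+\<omega>. (\<Sum>S\<in>Pow {..<N}. ?err S \<omega> + ennreal (a\<^sup>2 / 4) * ?cost S \<omega>) \<partial>M)"
    by (intro nn_integral_mono square_error_plus_cost_ge A)
  also have "\<dots> = (\<Sum>S\<in>Pow {..<N}. (\<integral>\<^sup>+\<omega>. ?err S \<omega> \<partial>M) + ennreal (a\<^sup>2 / 4) * (\<integral>\<^sup>+\<omega>. ?cost S \<omega> \<partial>M))"
  proof (subst nn_integral_sum)
    show "(\<lambda>\<omega>. ?err S \<omega> + ennreal (a\<^sup>2 / 4) * ?cost S \<omega>) \<in> borel_measurable M"
      if "S \<in> Pow {..<N}" for S
      by (rule borel_measurable_add[OF _ borel_measurable_times_ennreal[OF borel_measurable_const]])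
         (use meas[of S] that in blast)+
    show "(\<Sum>S\<in>Pow {..<N}. \<integral>\<^sup>+\<omega>. ?err S \<omega> + ennreal (a\<^sup>2 / 4) * ?cost S \<omega> \<partial>M)
        = (\<Sum>S\<in>Pow {..<N}. (\<integral>\<^sup>+\<omega>. ?err S \<omega> \<partial>M) + ennreal (a\<^sup>2 / 4) * (\<integral>\<^sup>+\<omega>. ?cost S \<omega> \<partial>M))"
    proof (rule sum.cong)
      fix S assume "S \<in> Pow {..<N}"
      then have m: "?err S \<in> borel_measurable M" "?cost S \<in> borel_measurable M" using meas[of S] by auto
      show "(\<integral>\<^sup>+\<omega>. ?err S \<omega> + ennreal (a\<^sup>2 / 4) * ?cost S \<omega> \<partial>M)
        = (\<integral>\<^sup>+\<omega>. ?err S \<omega> \<partial>M) + ennreal (a\<^sup>2 / 4) * (\<integral>\<^sup>+\<omega>. ?cost S \<omega> \<partial>M)"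
        unfolding nn_integral_add[OF m(1) borel_measurable_times_ennreal[OF borel_measurable_const m(2)]]
          nn_integral_cmult[OF m(2)] ..
    qed simp
  qed
  also have "\<dots> \<le> (\<Sum>S\<in>Pow {..<N}. ennreal (\<epsilon>\<^sup>2) + ennreal (a\<^sup>2 / 4) * rcost F M A)"
    by (intro sum_mono add_mono mult_left_mono err_le cost_le) auto
  finally have *: "2 ^ N * ennreal (a\<^sup>2 / 4 * N) \<le> 2 ^ N * (ennreal (\<epsilon>\<^sup>2) + ennreal (a\<^sup>2 / 4) * rcost F M A)"
    by (simp add: card_Pow)
  show "ennreal (N / 2) \<le> rcost F (fst (M, A)) (snd (M, A))"
  proof (cases "rcost F M A")
    case (real c)
    have two: "(2::ennreal) ^ N = ennreal (2 ^ N)" by (simp flip: ennreal_power)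
    have "ennreal (\<epsilon>\<^sup>2) + ennreal (a\<^sup>2 / 4) * rcost F M A = ennreal (\<epsilon>\<^sup>2 + a\<^sup>2 / 4 * c)"
      using real by (simp add: ennreal_mult[symmetric])
    with * have le: "ennreal (2 ^ N) * ennreal (a\<^sup>2 / 4 * N) \<le> ennreal (2 ^ N) * ennreal (\<epsilon>\<^sup>2 + a\<^sup>2 / 4 * c)"
      unfolding two by simp
    have mult: "ennreal (2 ^ N) * ennreal x = ennreal (2 ^ N * x)" if "0 \<le> x" for x
      using that by (intro ennreal_mult[symmetric]) auto
    have "0 \<le> a\<^sup>2 / 4 * N" "0 \<le> \<epsilon>\<^sup>2 + a\<^sup>2 / 4 * c" using real by simp_all
    from le[unfolded mult[OF this(1)] mult[OF this(2)]]
    have "ennreal (2 ^ N * (a\<^sup>2 / 4 * N)) \<le> ennreal (2 ^ N * (\<epsilon>\<^sup>2 + a\<^sup>2 / 4 * c))"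
      .
    then have "2 ^ N * (a\<^sup>2 / 4 * N) \<le> 2 ^ N * (\<epsilon>\<^sup>2 + a\<^sup>2 / 4 * c)"
      using real by (subst (asm) ennreal_le_iff) auto
    then have "a\<^sup>2 * N \<le> 4 * \<epsilon>\<^sup>2 + a\<^sup>2 * c" by simp
    then have "a\<^sup>2 * (N / 2) \<le> a\<^sup>2 * c" using assms by simp
    then show ?thesis using a_pos real by (simp add: ennreal_leI)
  qed simp
qed

end

section \<open>Quantum algorithms\<close>

definition cinner :: "nat \<Rightarrow> (nat \<Rightarrow> complex) \<Rightarrow> (nat \<Rightarrow> complex) \<Rightarrow> complex" where
  "cinner M u v = (\<Sum>a<M. cnj (u a) * v a)"

lemma cinner_self: "cinner M u u = of_real (\<Sum>a<M. (cmod (u a))\<^sup>2)"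
  by (simp add: cinner_def complex_norm_square[symmetric] mult.commute del: of_real_power)

lemma cinner_scale: "cinner M (\<lambda>a. c * u a) (\<lambda>a. d * v a) = cnj c * d * cinner M u v"
  by (simp add: cinner_def sum_distrib_left mult_ac)

lemma cinner_mat_app:
  assumes "unitary_mat M U"
  shows "cinner M (mat_app M U u) (mat_app M U v) = cinner M u v"
proof -
  have "cinner M (mat_app M U u) (mat_app M U v)
      = (\<Sum>k<M. \<Sum>a<M. \<Sum>b<M. cnj (u a) * v b * (cnj (U k a) * U k b))"
    unfolding cinner_def mat_app_def cnj_sum sum_product by (intro sum.cong refl) (simp add: mult_ac)
  also have "\<dots> = (\<Sum>a<M. \<Sum>b<M. \<Sum>k<M. cnj (u a) * v b * (cnj (U k a) * U k b))"
    by (subst sum.swap, rule sum.cong[OF refl], rule sum.swap)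
  also have "\<dots> = (\<Sum>a<M. \<Sum>b<M. cnj (u a) * v b * (if a = b then 1 else 0))"
    using assms unfolding sum_distrib_left[symmetric] unitary_mat_def by (intro sum.cong) auto
  also have "\<dots> = (\<Sum>a<M. cnj (u a) * v a)"
    by (simp add: if_distrib[of "(*) _"] sum.delta cong: if_cong)
  finally show ?thesis by (simp add: cinner_def)
qed

definition qblock :: "qawm \<Rightarrow> nat \<Rightarrow> nat" where
  "qblock Q l = l div 2 ^ (qm Q - qm1 Q)"

definition answer :: "qawm \<Rightarrow> (real \<Rightarrow> real) \<Rightarrow> nat \<Rightarrow> real" where
  "answer Q f i = dd f (snd (qtau Q i)) (fst (qtau Q i))"

lemma qperm_eq: "qperm Q f l = (if qblock Q l \<in> qZ Q
    then l - l mod 2 ^ qm2 Q + Bit_Operations.xor (l mod 2 ^ qm2 Q) (qbeta Q (answer Q f (qblock Q l))) else l)"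
  by (simp add: qperm_def qblock_def answer_def Let_def split_def)

lemma xor_less_exp:
  fixes x y :: nat
  assumes "x < 2 ^ n" "y < 2 ^ n" shows "Bit_Operations.xor x y < 2 ^ n"
  using assms by (metis take_bit_nat_eq_self_iff take_bit_xor)

text \<open>A query changes only the lowest \<open>qm2 Q\<close> bits, which do not reach the
  \<open>qm1 Q\<close> high bits holding the block index; so it preserves the block, and as XOR with
  a fixed string it undoes itself.\<close>

lemma
  assumes "qawm_valid r Q"
  shows qperm_qperm: "qperm Q f (qperm Q f l) = l"
    and qblock_qperm: "qblock Q (qperm Q f l) = qblock Q l"
    and qperm_less: "l < 2 ^ qm Q \<Longrightarrow> qperm Q f l < 2 ^ qm Q"
proof -
  define n where "n = qm2 Q"
  define y where "y = Bit_Operations.xor (l mod 2 ^ n) (qbeta Q (answer Q f (qblock Q l)))"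
  have bits: "n \<le> qm Q - qm1 Q" "n \<le> qm Q" and beta: "\<And>z. qbeta Q z < 2 ^ n"
    using assms by (auto simp: qawm_valid_def n_def)
  have y: "y < 2 ^ n" unfolding y_def by (intro xor_less_exp beta) simp
  have perm: "qperm Q f l = (if qblock Q l \<in> qZ Q then l div 2 ^ n * 2 ^ n + y else l)"
    by (simp add: qperm_eq y_def n_def minus_mod_eq_div_mult)
  have div: "qperm Q f l div 2 ^ n = l div 2 ^ n" using y by (simp add: perm)
  have coarse: "x div 2 ^ k = x div 2 ^ n div 2 ^ (k - n)" if "n \<le> k" for x k :: nat
    using that by (simp add: div_mult2_eq[symmetric] power_add[symmetric])
  show block: "qblock Q (qperm Q f l) = qblock Q l"
    unfolding qblock_def using coarse[OF bits(1)] div by simp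
  have "x < 2 ^ qm Q \<longleftrightarrow> x div 2 ^ n div 2 ^ (qm Q - n) = 0" for x :: nat
    using coarse[OF bits(2), of x] by (metis div_eq_0_iff power_not_zero zero_neq_numeral)
  then show "l < 2 ^ qm Q \<Longrightarrow> qperm Q f l < 2 ^ qm Q" using div by simp
  show "qperm Q f (qperm Q f l) = l"
  proof (cases "qblock Q l \<in> qZ Q")
    case True
    have "qperm Q f l mod 2 ^ n = y" using y True by (simp add: perm)
    then have "qperm Q f (qperm Q f l) = qperm Q f l div 2 ^ n * 2 ^ n
        + Bit_Operations.xor y (qbeta Q (answer Q f (qblock Q l)))"
      using True minus_mod_eq_div_mult[of "qperm Q f l" "2 ^ n"]
      by (simp add: qperm_eq[of Q f "qperm Q f l"] block n_def[symmetric])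
    also have "Bit_Operations.xor y (qbeta Q (answer Q f (qblock Q l))) = l mod 2 ^ n"
      by (simp add: y_def xor.assoc)
    finally show ?thesis by (simp only: div div_mult_mod_eq)
  qed (simp add: perm)
qed

lemma mat_app_qquery:
  assumes "qawm_valid r Q" "a < 2 ^ qm Q"
  shows "mat_app (2 ^ qm Q) (qquery Q f) v a = v (qperm Q f a)"
proof -
  have "a = qperm Q f b \<longleftrightarrow> b = qperm Q f a" for b using qperm_qperm[OF assms(1)] by metis
  then have "mat_app (2 ^ qm Q) (qquery Q f) v a
      = (\<Sum>b<2 ^ qm Q. if b = qperm Q f a then v b else 0)"
    unfolding mat_app_def qquery_def by (intro sum.cong) auto
  then show ?thesis using qperm_less[OF assms] by simp
qed

lemma sum_qperm:
  fixes g :: "nat \<Rightarrow> 'a :: comm_monoid_add"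
  assumes "qawm_valid r Q"
  shows "(\<Sum>a | a < 2 ^ qm Q \<and> P (qblock Q a). g (qperm Q f a))
       = (\<Sum>a | a < 2 ^ qm Q \<and> P (qblock Q a). g a)"
  by (rule sum.reindex_bij_witness[of _ "qperm Q f" "qperm Q f"])
     (auto simp: qperm_qperm[OF assms] qblock_qperm[OF assms] qperm_less[OF assms])

definition query_weight :: "qawm \<Rightarrow> nat set \<Rightarrow> (nat \<Rightarrow> complex) \<Rightarrow> real" where
  "query_weight Q I u = (\<Sum>a | a < 2 ^ qm Q \<and> qblock Q a \<in> qZ Q \<inter> I. (cmod (u a))\<^sup>2)"

lemma query_weight_scale: "query_weight Q I (\<lambda>a. c * u a) = (cmod c)\<^sup>2 * query_weight Q I u"
  by (simp add: query_weight_def norm_mult power_mult_distrib sum_distrib_left)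

text \<open>Blocks on which both oracles agree contribute equally to the inner product before and after
  the query, so only the weight on the distinguishing blocks \<open>I\<close> matters.\<close>

lemma cinner_query_diff:
  assumes Q: "qawm_valid r Q"
    and agree: "\<And>i. i \<in> qZ Q \<Longrightarrow> i \<notin> I \<Longrightarrow> answer Q g i = answer Q h i"
  shows "cmod (cinner (2 ^ qm Q) (mat_app (2 ^ qm Q) (qquery Q g) u) (mat_app (2 ^ qm Q) (qquery Q h) v)
           - cinner (2 ^ qm Q) u v) \<le> query_weight Q I u + query_weight Q I v"
proof -
  define In where "In = {a. a < 2 ^ qm Q \<and> qblock Q a \<in> qZ Q \<inter> I}"
  define Out where "Out = {a. a < 2 ^ qm Q \<and> qblock Q a \<notin> qZ Q \<inter> I}"
  have fin: "finite In" "finite Out" by (simp_all add: In_def Out_def)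
  have split: "(\<Sum>a<2 ^ qm Q. F a) = (\<Sum>a\<in>In. F a) + (\<Sum>a\<in>Out. F a)" for F :: "nat \<Rightarrow> complex"
    by (subst sum.union_disjoint[symmetric, OF fin]) (auto simp: In_def Out_def intro!: sum.cong)
  have "(\<Sum>a\<in>Out. cnj (u (qperm Q g a)) * v (qperm Q h a)) = (\<Sum>a\<in>Out. cnj (u (qperm Q g a)) * v (qperm Q g a))"
  proof (intro sum.cong refl)
    fix a assume "a \<in> Out"
    then have "qperm Q h a = qperm Q g a" using agree[of "qblock Q a"] by (auto simp: qperm_eq Out_def)
    then show "cnj (u (qperm Q g a)) * v (qperm Q h a) = cnj (u (qperm Q g a)) * v (qperm Q g a)" by simp
  qed
  also have "\<dots> = (\<Sum>a\<in>Out. cnj (u a) * v a)"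
    unfolding Out_def by (rule sum_qperm[OF Q, where P = "\<lambda>i. i \<notin> qZ Q \<inter> I"])
  finally have out: "(\<Sum>a\<in>Out. cnj (u (qperm Q g a)) * v (qperm Q h a)) = (\<Sum>a\<in>Out. cnj (u a) * v a)" .
  have amgm: "cmod (\<Sum>a\<in>In. cnj (x a) * y a) \<le> ((\<Sum>a\<in>In. (cmod (x a))\<^sup>2) + (\<Sum>a\<in>In. (cmod (y a))\<^sup>2)) / 2"
    for x y :: "nat \<Rightarrow> complex"
  proof -
    have "cmod (\<Sum>a\<in>In. cnj (x a) * y a) \<le> (\<Sum>a\<in>In. cmod (x a) * cmod (y a))"
      by (rule sum_norm_le) (simp add: norm_mult)
    also have "\<dots> \<le> (\<Sum>a\<in>In. ((cmod (x a))\<^sup>2 + (cmod (y a))\<^sup>2) / 2)"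
    proof (rule sum_mono)
      fix a
      show "cmod (x a) * cmod (y a) \<le> ((cmod (x a))\<^sup>2 + (cmod (y a))\<^sup>2) / 2"
        using sum_squares_bound[of "cmod (x a)" "cmod (y a)"] by simp
    qed
    finally show ?thesis by (simp add: sum.distrib sum_divide_distrib[symmetric])
  qed
  \<comment> \<open>The query permutes \<open>In\<close>, so the weights before and after it are
    equal, and the two halves given by \<open>amgm\<close> add up to the full weights.\<close>
  have wt: "(\<Sum>a\<in>In. (cmod (x (qperm Q k a)))\<^sup>2) = query_weight Q I x" "(\<Sum>a\<in>In. (cmod (x a))\<^sup>2) = query_weight Q I x" for x k
    unfolding query_weight_def In_def
    by (rule sum_qperm[OF Q, where P = "\<lambda>i. i \<in> qZ Q \<inter> I" and g = "\<lambda>a. (cmod (x a))\<^sup>2"]) simp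
  have "cinner (2 ^ qm Q) (mat_app (2 ^ qm Q) (qquery Q g) u) (mat_app (2 ^ qm Q) (qquery Q h) v)
      = (\<Sum>a<2 ^ qm Q. cnj (u (qperm Q g a)) * v (qperm Q h a))"
    unfolding cinner_def by (intro sum.cong) (simp_all add: mat_app_qquery[OF Q])
  then have "cinner (2 ^ qm Q) (mat_app (2 ^ qm Q) (qquery Q g) u) (mat_app (2 ^ qm Q) (qquery Q h) v)
      - cinner (2 ^ qm Q) u v
      = (\<Sum>a\<in>In. cnj (u (qperm Q g a)) * v (qperm Q h a)) - (\<Sum>a\<in>In. cnj (u a) * v a)"
    by (simp add: cinner_def split out)
  also have "cmod \<dots> \<le> cmod (\<Sum>a\<in>In. cnj (u (qperm Q g a)) * v (qperm Q h a)) + cmod (\<Sum>a\<in>In. cnj (u a) * v a)"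
    by (rule norm_triangle_ineq4)
  also have "\<dots> \<le> query_weight Q I u + query_weight Q I v"
    using amgm[of "\<lambda>a. u (qperm Q g a)" "\<lambda>a. v (qperm Q h a)"] amgm[of u v] by (simp add: wt)
  finally show ?thesis .
qed

lemma cinner_qstate_0:
  assumes "qawm_valid r Q"
  shows "cinner (2 ^ qm Q) (qstate Q g 0) (qstate Q h 0) = 1"
proof -
  have "unitary_mat (2 ^ qm Q) (qU Q 0)" using assms by (simp add: qawm_valid_def)
  then have "cinner (2 ^ qm Q) (qstate Q g 0) (qstate Q h 0)
      = cinner (2 ^ qm Q) (\<lambda>a. if a = 0 then 1 else 0) (\<lambda>a. if a = 0 then 1 else 0)"
    by (simp add: cinner_mat_app)
  also have "\<dots> = (\<Sum>a::nat<2 ^ qm Q. if a = 0 then 1 else 0)"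
    unfolding cinner_def by (intro sum.cong) auto
  finally show ?thesis by simp
qed

lemma mat_app_scale: "mat_app M U (\<lambda>a. c * u a) = (\<lambda>a. c * mat_app M U u a)"
  by (simp add: mat_app_def sum_distrib_left mult_ac fun_eq_iff)

text \<open>The factors \<open>c\<close> and \<open>d\<close> stand for the amplitudes of the
  earlier measurement record. They are moved into the states before the arithmetic-geometric mean
  inequality is applied, so that each weight is multiplied by the squared modulus of its own
  amplitude and no mixed factor remains.\<close>

lemma stage_overlap:
  assumes Q: "qawm_valid r Q"
    and agree: "\<And>i. i \<in> qZ Q \<Longrightarrow> i \<notin> I \<Longrightarrow> answer Q g i = answer Q h i"
    and "n \<le> qn Q"
  shows "cmod (cnj c * d * (cinner (2 ^ qm Q) (qstate Q g n) (qstate Q h n) - 1))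
      \<le> (\<Sum>k<n. (cmod c)\<^sup>2 * query_weight Q I (qstate Q g k) + (cmod d)\<^sup>2 * query_weight Q I (qstate Q h k))"
  using \<open>n \<le> qn Q\<close>
proof (induction n)
  case 0
  then show ?case by (simp add: cinner_qstate_0[OF Q] del: qstate.simps)
next
  case (Suc n)
  let ?M = "2 ^ qm Q"
  have U: "unitary_mat ?M (qU Q (Suc n))" using Q Suc.prems by (simp add: qawm_valid_def)
  define G where "G = cinner ?M (qstate Q g n) (qstate Q h n)"
  define G' where "G' = cinner ?M (mat_app ?M (qquery Q g) (qstate Q g n)) (mat_app ?M (qquery Q h) (qstate Q h n))"
  let ?u = "\<lambda>a. c * qstate Q g n a" and ?v = "\<lambda>a. d * qstate Q h n a"
  have Suc_n: "cinner ?M (qstate Q g (Suc n)) (qstate Q h (Suc n)) = G'"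
    unfolding qstate.simps G'_def by (rule cinner_mat_app[OF U])
  have e1: "cnj c * d * G' = cinner ?M (mat_app ?M (qquery Q g) ?u) (mat_app ?M (qquery Q h) ?v)"
    by (simp only: mat_app_scale cinner_scale G'_def)
  have e2: "cnj c * d * G = cinner ?M ?u ?v"
    by (simp only: cinner_scale G_def)
  have eq: "cnj c * d * (cinner ?M (qstate Q g (Suc n)) (qstate Q h (Suc n)) - 1)
      = (cinner ?M (mat_app ?M (qquery Q g) ?u) (mat_app ?M (qquery Q h) ?v) - cinner ?M ?u ?v) + cnj c * d * (G - 1)"
    unfolding Suc_n e1[symmetric] e2[symmetric] by (simp add: algebra_simps)
  have "cmod (cnj c * d * (cinner ?M (qstate Q g (Suc n)) (qstate Q h (Suc n)) - 1))
      \<le> (query_weight Q I ?u + query_weight Q I ?v)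
      + (\<Sum>k<n. (cmod c)\<^sup>2 * query_weight Q I (qstate Q g k) + (cmod d)\<^sup>2 * query_weight Q I (qstate Q h k))"
    unfolding eq
  proof (rule norm_triangle_le[OF add_mono])
    show "cmod (cinner ?M (mat_app ?M (qquery Q g) ?u) (mat_app ?M (qquery Q h) ?v) - cinner ?M ?u ?v)
        \<le> query_weight Q I ?u + query_weight Q I ?v"
      by (rule cinner_query_diff[OF Q]) (rule agree)
    show "cmod (cnj c * d * (G - 1))
        \<le> (\<Sum>k<n. (cmod c)\<^sup>2 * query_weight Q I (qstate Q g k) + (cmod d)\<^sup>2 * query_weight Q I (qstate Q h k))"
      unfolding G_def using Suc.prems by (intro Suc.IH) simp
  qed
  then show ?case unfolding query_weight_scale by (simp only: sum.lessThan_Suc add.commute)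
qed

text \<open>The case of two equal oracles and an empty distinguishing set: the overlap with itself
  never leaves 1.\<close>

lemma qstate_norm:
  assumes Q: "qawm_valid r Q" and "n \<le> qn Q"
  shows "(\<Sum>a<2 ^ qm Q. (cmod (qstate Q g n a))\<^sup>2) = 1"
proof -
  have "cmod (cnj 1 * 1 * (cinner (2 ^ qm Q) (qstate Q g n) (qstate Q g n) - 1)) \<le> 0"
    using stage_overlap[OF Q _ assms(2), of "{}" g g 1 1] by (simp add: query_weight_def)
  then have "complex_of_real (\<Sum>a<2 ^ qm Q. (cmod (qstate Q g n a))\<^sup>2) = 1"
    by (simp add: cinner_self)
  then show ?thesis by (simp only: of_real_eq_1_iff)
qed

section \<open>Algorithms with several measurements\<close>

text \<open>Amplitudes of the measurement record when all measurements are deferred to the end.\<close>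

definition amp :: "qalg \<Rightarrow> (real \<Rightarrow> real) \<Rightarrow> nat list \<Rightarrow> complex" where
  "amp A g xs = (\<Prod>l<length xs. qstate (qstage A (take l xs)) g (qn (qstage A (take l xs))) (xs ! l))"

definition records :: "qalg \<Rightarrow> nat \<Rightarrow> nat list set" where
  "records A l = {xs. length xs = l \<and> qvalid_prefix A xs}"

definition overlap :: "qalg \<Rightarrow> (real \<Rightarrow> real) \<Rightarrow> (real \<Rightarrow> real) \<Rightarrow> nat \<Rightarrow> complex" where
  "overlap A g h l = (\<Sum>xs\<in>records A l. cnj (amp A g xs) * amp A h xs)"

lemma amp_snoc: "amp A g (xs @ [a]) = amp A g xs * qstate (qstage A xs) g (qn (qstage A xs)) a"
proof -
  have "(\<Prod>l<length xs. qstate (qstage A (take l (xs @ [a]))) g (qn (qstage A (take l (xs @ [a])))) ((xs @ [a]) ! l)) = amp A g xs"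
    unfolding amp_def by (intro prod.cong) (auto simp: nth_append)
  then show ?thesis by (simp add: amp_def lessThan_Suc mult.commute)
qed

lemma records_0: "records A 0 = {[]}"
  by (auto simp: records_def qvalid_prefix_def)

lemma qvalid_prefix_snoc:
  "qvalid_prefix A (xs @ [a]) \<longleftrightarrow> qvalid_prefix A xs \<and> a < 2 ^ qm (qstage A xs)"
  by (auto simp: qvalid_prefix_def nth_append less_Suc_eq)

lemma records_Suc:
  "records A (Suc l) = (\<lambda>(xs, a). xs @ [a]) ` (SIGMA xs:records A l. {..<2 ^ qm (qstage A xs)})"
proof
  show "records A (Suc l) \<subseteq> (\<lambda>(xs, a). xs @ [a]) ` (SIGMA xs:records A l. {..<2 ^ qm (qstage A xs)})"
  proof
    fix ys assume ys: "ys \<in> records A (Suc l)"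
    then obtain xs a where "ys = xs @ [a]" by (cases ys rule: rev_cases) (auto simp: records_def)
    with ys show "ys \<in> (\<lambda>(xs, a). xs @ [a]) ` (SIGMA xs:records A l. {..<2 ^ qm (qstage A xs)})"
      by (intro image_eqI[of _ _ "(xs, a)"]) (auto simp: records_def qvalid_prefix_snoc)
  qed
qed (auto simp: records_def qvalid_prefix_snoc)

lemma finite_records: "finite (records A l)"
  by (induction l) (auto simp: records_0 records_Suc)

lemma sum_records_Suc:
  "(\<Sum>xs\<in>records A (Suc l). F xs) = (\<Sum>xs\<in>records A l. \<Sum>a<2 ^ qm (qstage A xs). F (xs @ [a]))"
proof -
  have "(\<Sum>xs\<in>records A (Suc l). F xs) = (\<Sum>(xs, a)\<in>(SIGMA xs:records A l. {..<2 ^ qm (qstage A xs)}). F (xs @ [a]))"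
    unfolding records_Suc by (subst sum.reindex) (auto simp: inj_on_def split_def)
  then show ?thesis by (simp add: sum.Sigma finite_records)
qed

lemma overlap_Suc:
  "overlap A g h (Suc l) = (\<Sum>xs\<in>records A l. cnj (amp A g xs) * amp A h xs *
     (let Q = qstage A xs in cinner (2 ^ qm Q) (qstate Q g (qn Q)) (qstate Q h (qn Q))))"
  unfolding overlap_def Let_def
  unfolding sum_records_Suc cinner_def sum_distrib_left
  by (intro sum.cong refl) (simp add: amp_snoc mult_ac)

lemma amp_norm:
  assumes "\<And>xs. qawm_valid r (qstage A xs)"
  shows "(\<Sum>xs\<in>records A l. (cmod (amp A g xs))\<^sup>2) = 1"
proof (induction l)
  case 0
  then show ?case by (simp add: records_0 amp_def)
next
  case (Suc l)
  have "(\<Sum>a<2 ^ qm (qstage A xs). (cmod (amp A g (xs @ [a])))\<^sup>2) = (cmod (amp A g xs))\<^sup>2" for xs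
    using qstate_norm[OF assms order_refl, of xs g]
    by (simp add: amp_snoc norm_mult power_mult_distrib sum_distrib_left[symmetric])
  then show ?case using Suc by (simp add: sum_records_Suc)
qed

text \<open>The expected query mass on the blocks \<open>I\<close> during the whole run.
  \<open>I\<close> takes the stage as argument because every stage encodes its query points by its
  own \<open>qtau\<close>.\<close>

definition total_weight :: "qalg \<Rightarrow> (qawm \<Rightarrow> nat set) \<Rightarrow> (real \<Rightarrow> real) \<Rightarrow> real" where
  "total_weight A I g = (\<Sum>l<qk A. \<Sum>xs\<in>records A l. \<Sum>k<qn (qstage A xs).
     (cmod (amp A g xs))\<^sup>2 * query_weight (qstage A xs) (I (qstage A xs)) (qstate (qstage A xs) g k))"

text \<open>The overlap starts at 1 and each stage moves it by at most the weight spent on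
  distinguishing blocks; the bound telescopes over the stages.\<close>

lemma overlap_ge:
  assumes Q: "\<And>xs. qawm_valid r (qstage A xs)"
    and agree: "\<And>xs i. i \<in> qZ (qstage A xs) \<Longrightarrow> i \<notin> I (qstage A xs)
        \<Longrightarrow> answer (qstage A xs) g i = answer (qstage A xs) h i"
  shows "1 - cmod (overlap A g h (qk A)) \<le> total_weight A I g + total_weight A I h"
proof -
  define w where "w f l = (\<Sum>xs\<in>records A l. \<Sum>k<qn (qstage A xs).
     (cmod (amp A f xs))\<^sup>2 * query_weight (qstage A xs) (I (qstage A xs)) (qstate (qstage A xs) f k))" for f l
  have step: "cmod (overlap A g h (Suc l) - overlap A g h l) \<le> w g l + w h l" for l
  proof -
    have "overlap A g h (Suc l) - overlap A g h l
        = (\<Sum>xs\<in>records A l. cnj (amp A g xs) * amp A h xs *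
     (let Q = qstage A xs in cinner (2 ^ qm Q) (qstate Q g (qn Q)) (qstate Q h (qn Q)) - 1))"
      unfolding overlap_Suc overlap_def[of A g h l] by (simp add: sum_subtractf right_diff_distrib Let_def)
    also have "cmod \<dots> \<le> (\<Sum>xs\<in>records A l. \<Sum>k<qn (qstage A xs).
        (cmod (amp A g xs))\<^sup>2 * query_weight (qstage A xs) (I (qstage A xs)) (qstate (qstage A xs) g k)
      + (cmod (amp A h xs))\<^sup>2 * query_weight (qstage A xs) (I (qstage A xs)) (qstate (qstage A xs) h k))"
      unfolding Let_def using agree by (intro sum_norm_le stage_overlap[OF Q] order_refl)
    finally show ?thesis by (simp add: w_def sum.distrib)
  qed
  have "cmod (overlap A g h l - 1) \<le> (\<Sum>l<l. w g l + w h l)" for l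
  proof (induction l)
    case 0
    then show ?case by (simp add: overlap_def records_0 amp_def)
  next
    case (Suc l)
    have "cmod (overlap A g h (Suc l) - 1)
        \<le> cmod (overlap A g h (Suc l) - overlap A g h l) + cmod (overlap A g h l - 1)"
      by (rule norm_triangle_ineq[of "overlap A g h (Suc l) - overlap A g h l" "overlap A g h l - 1", simplified])
    then show ?case using Suc step[of l] by simp
  qed
  from this[of "qk A"] have "cmod (overlap A g h (qk A) - 1) \<le> total_weight A I g + total_weight A I h"
    by (simp add: total_weight_def w_def sum.distrib)
  moreover have "1 - cmod (overlap A g h (qk A)) \<le> cmod (overlap A g h (qk A) - 1)"
    using norm_triangle_ineq2[of 1 "overlap A g h (qk A)"] by (simp add: norm_minus_commute)
  ultimately show ?thesis by linarith
qed

text \<open>At each query the state has norm 1 and the block sets are disjoint, so the weights over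
  \<open>J\<close> sum to at most 1. Record probabilities also sum to 1, hence stage
  \<open>l\<close> contributes at most \<open>T l\<close>; bounds per stage, uniform over records,
  match the way \<open>qcost\<close> counts.\<close>

lemma sum_total_weight_le:
  assumes Q: "\<And>xs. qawm_valid r (qstage A xs)"
    and J: "finite J" and disj: "\<And>Q i j. i \<in> J \<Longrightarrow> j \<in> J \<Longrightarrow> i \<noteq> j \<Longrightarrow> I i Q \<inter> I j Q = {}"
    and T: "\<And>l xs. l < qk A \<Longrightarrow> xs \<in> records A l \<Longrightarrow> real (qn (qstage A xs)) \<le> T l"
  shows "(\<Sum>j\<in>J. total_weight A (I j) g) \<le> (\<Sum>l<qk A. T l)"
proof -
  have wt: "(\<Sum>j\<in>J. query_weight Q (I j Q) (qstate Q g k)) \<le> 1" if Q: "qawm_valid r Q" "k \<le> qn Q" for Q k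
  proof -
    have "(\<Sum>j\<in>J. query_weight Q (I j Q) (qstate Q g k))
        = (\<Sum>a\<in>(\<Union>j\<in>J. {a. a < 2 ^ qm Q \<and> qblock Q a \<in> qZ Q \<inter> I j Q}). (cmod (qstate Q g k a))\<^sup>2)"
      unfolding query_weight_def using J disj[of _ _ Q] by (subst sum.UNION_disjoint) auto
    also have "\<dots> \<le> (\<Sum>a<2 ^ qm Q. (cmod (qstate Q g k a))\<^sup>2)"
      by (rule sum_mono2) auto
    finally show ?thesis using qstate_norm[OF Q] by simp
  qed
  have "(\<Sum>j\<in>J. total_weight A (I j) g) = (\<Sum>l<qk A. \<Sum>xs\<in>records A l. \<Sum>k<qn (qstage A xs).
     (cmod (amp A g xs))\<^sup>2 * (\<Sum>j\<in>J. query_weight (qstage A xs) (I j (qstage A xs)) (qstate (qstage A xs) g k)))"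
    unfolding total_weight_def sum_distrib_left
    by (subst sum.swap, rule sum.cong[OF refl], subst sum.swap, rule sum.cong[OF refl], rule sum.swap)
  also have "\<dots> \<le> (\<Sum>l<qk A. \<Sum>xs\<in>records A l. \<Sum>k<qn (qstage A xs). (cmod (amp A g xs))\<^sup>2 * 1)"
    by (intro sum_mono mult_left_mono wt Q) auto
  also have "\<dots> \<le> (\<Sum>l<qk A. \<Sum>xs\<in>records A l. T l * (cmod (amp A g xs))\<^sup>2)"
    using T by (intro sum_mono) (auto intro!: mult_right_mono)
  also have "\<dots> = (\<Sum>l<qk A. T l)"
    by (simp add: sum_distrib_left[symmetric] amp_norm[OF Q])
  finally show ?thesis .
qed

lemma qP_eq: "xs \<in> qoutcomes A \<Longrightarrow> qP A g xs = (cmod (amp A g xs))\<^sup>2"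
  by (simp add: qoutcomes_def qP_def qprob_def amp_def Let_def prod_norm[symmetric] prod_power_distrib)

lemma qoutcomes_eq: "qoutcomes A = records A (qk A)"
  by (simp add: qoutcomes_def records_def)

text \<open>\<open>qerr\<close> is an infimum that need not be attained, hence the strict
  inequality. The set is nonempty because no error exceeds the sum of the absolute values of all
  errors.\<close>

lemma success_prob_ge:
  assumes Q: "\<And>xs. qawm_valid r (qstage A xs)" and "qerr e g A < \<alpha>"
  shows "3/4 \<le> (\<Sum>xs\<in>{xs \<in> records A (qk A). e g (qphi A xs) \<le> \<alpha>}. (cmod (amp A g xs))\<^sup>2)"
proof -
  define X where "X = {\<alpha>. 0 \<le> \<alpha> \<and> (\<Sum>xs\<in>qoutcomes A. if e g (qphi A xs) > \<alpha> then qP A g xs else 0) \<le> 1/4}"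
  have fin: "finite (qoutcomes A)" by (simp add: qoutcomes_eq finite_records)
  have "(\<Sum>xs\<in>qoutcomes A. \<bar>e g (qphi A xs)\<bar>) \<in> X"
  proof -
    have "e g (qphi A xs) \<le> (\<Sum>xs\<in>qoutcomes A. \<bar>e g (qphi A xs)\<bar>)" if "xs \<in> qoutcomes A" for xs
      using member_le_sum[of xs "qoutcomes A" "\<lambda>xs. \<bar>e g (qphi A xs)\<bar>"] that fin by simp
    then have "(\<Sum>xs\<in>qoutcomes A. if e g (qphi A xs) > (\<Sum>xs\<in>qoutcomes A. \<bar>e g (qphi A xs)\<bar>) then qP A g xs else 0) = 0"
      by (intro sum.neutral) (auto simp: not_less[symmetric])
    then show ?thesis by (simp add: X_def sum_nonneg)
  qed
  then have "X \<noteq> {}" by blast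
  moreover have "Inf X < \<alpha>" using assms(2) by (simp add: qerr_def X_def)
  ultimately obtain \<beta> where \<beta>: "\<beta> \<in> X" "\<beta> < \<alpha>" by (rule cInf_lessD[THEN bexE])
  have "(\<Sum>xs\<in>{xs \<in> records A (qk A). \<not> e g (qphi A xs) \<le> \<alpha>}. (cmod (amp A g xs))\<^sup>2)
      = (\<Sum>xs\<in>qoutcomes A. if e g (qphi A xs) > \<alpha> then qP A g xs else 0)"
    unfolding qoutcomes_eq[symmetric] using fin
    by (intro sum.mono_neutral_cong_left) (auto simp: qP_eq)
  also have "\<dots> \<le> (\<Sum>xs\<in>qoutcomes A. if e g (qphi A xs) > \<beta> then qP A g xs else 0)"
    using \<beta>(2) by (intro sum_mono) (auto simp: qP_eq)
  also have "\<dots> \<le> 1/4" using \<beta>(1) by (simp add: X_def)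
  finally have le: "(\<Sum>xs\<in>{xs \<in> records A (qk A). \<not> e g (qphi A xs) \<le> \<alpha>}. (cmod (amp A g xs))\<^sup>2) \<le> 1/4" .
  have "(\<Sum>xs\<in>records A (qk A). (cmod (amp A g xs))\<^sup>2)
      = (\<Sum>xs\<in>{xs \<in> records A (qk A). e g (qphi A xs) \<le> \<alpha>}. (cmod (amp A g xs))\<^sup>2)
      + (\<Sum>xs\<in>{xs \<in> records A (qk A). \<not> e g (qphi A xs) \<le> \<alpha>}. (cmod (amp A g xs))\<^sup>2)"
    by (subst sum.union_disjoint[symmetric]) (auto intro!: sum.cong simp: finite_records)
  then show ?thesis using le amp_norm[OF Q, where g = g and l = "qk A"] by linarith
qed

text \<open>On \<open>E\<close> the first state has mass \<open>p \<ge> 3/4\<close> and the second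
  \<open>q \<le> 1/4\<close>. Bounding products by \<open>x\<^sup>2 / 4 + y\<^sup>2\<close> on
  \<open>E\<close>, and with the roles exchanged off \<open>E\<close>, gives
  \<open>5/4 - 3/4 * p + 3/4 * q \<le> 7/8\<close> without square roots.\<close>

lemma overlap_le:
  assumes Q: "\<And>xs. qawm_valid r (qstage A xs)"
    and E: "E \<subseteq> records A (qk A)" "E' \<subseteq> records A (qk A)" "E \<inter> E' = {}"
    and p: "3/4 \<le> (\<Sum>xs\<in>E. (cmod (amp A g xs))\<^sup>2)" "3/4 \<le> (\<Sum>xs\<in>E'. (cmod (amp A h xs))\<^sup>2)"
  shows "cmod (overlap A g h (qk A)) \<le> 7/8"
proof -
  let ?R = "records A (qk A)"
  define m where "m f S = (\<Sum>xs\<in>S. (cmod (amp A f xs))\<^sup>2)" for f S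
  have fin: "finite ?R" "finite E" using finite_records finite_subset E by blast+
  have total: "m f E + m f (?R - E) = 1" for f
    using sum.subset_diff[OF E(1) fin(1), of "\<lambda>xs. (cmod (amp A f xs))\<^sup>2"] amp_norm[OF Q, where g = f and l = "qk A"]
    by (simp add: m_def)
  have "m h E' \<le> m h (?R - E)" unfolding m_def using E fin by (intro sum_mono2) auto
  then have p': "3/4 \<le> m g E" "m h E \<le> 1/4" using p total[of h] by (auto simp: m_def)
  have amgm: "x * y \<le> x\<^sup>2 / 4 + y\<^sup>2" "x * y \<le> x\<^sup>2 + y\<^sup>2 / 4" for x y :: real
    using zero_le_power2[of "x / 2 - y"] zero_le_power2[of "x - y / 2"]
    by (simp_all add: power2_eq_square algebra_simps)
  have "cmod (overlap A g h (qk A)) \<le> (\<Sum>xs\<in>?R. cmod (amp A g xs) * cmod (amp A h xs))"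
    unfolding overlap_def by (rule sum_norm_le) (simp add: norm_mult)
  also have "\<dots> = (\<Sum>xs\<in>?R - E. cmod (amp A g xs) * cmod (amp A h xs)) + (\<Sum>xs\<in>E. cmod (amp A g xs) * cmod (amp A h xs))"
    by (rule sum.subset_diff[OF E(1) fin(1)])
  also have "\<dots> \<le> (\<Sum>xs\<in>?R - E. (cmod (amp A g xs))\<^sup>2 + (cmod (amp A h xs))\<^sup>2 / 4) + (\<Sum>xs\<in>E. (cmod (amp A g xs))\<^sup>2 / 4 + (cmod (amp A h xs))\<^sup>2)"
    by (intro add_mono sum_mono amgm)
  also have "\<dots> = m g (?R - E) + m h (?R - E) / 4 + (m g E / 4 + m h E)"
    by (simp add: m_def sum.distrib sum_divide_distrib)
  finally show ?thesis using p' total[of g] total[of h] by linarith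
qed

section \<open>The adversary bound for neighbouring subsets\<close>

context hard_family
begin

definition cell_blocks :: "nat \<Rightarrow> qawm \<Rightarrow> nat set" where
  "cell_blocks j Q = {i. loc (fst (qtau Q i)) = j}"

text \<open>Adding one index moves the target by \<open>a > 2 * \<epsilon>\<close>, so no output is
  good for both sets. The overlap must therefore fall from 1 to 7/8, and only queries at
  \<open>j\<close> can lower it.\<close>

lemma edge_weight_ge:
  assumes Q: "\<And>xs. qawm_valid r (qstage A xs)" and phi: "\<And>xs. qphi A xs \<in> {0..1}"
    and err: "\<And>g. g \<in> F \<Longrightarrow> qerr e g A \<le> \<epsilon>" and \<epsilon>: "2 * \<epsilon> < a"
    and S: "S \<subseteq> {..<N}" "j < N" "j \<notin> S"
  shows "1/8 \<le> total_weight A (cell_blocks j) (f S) + total_weight A (cell_blocks j) (f (insert j S))"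
proof -
  define S' where "S' = insert j S"
  \<comment> \<open>The midpoint of \<epsilon> and \<open>a / 2\<close>: strictly above \<epsilon>
    to pass from the infimum to a probability, strictly below \<open>a / 2\<close> to keep the
    success events disjoint.\<close>
  define \<alpha> where "\<alpha> = (\<epsilon> + a / 2) / 2"
  have \<alpha>: "\<epsilon> < \<alpha>" "2 * \<alpha> < a" using \<epsilon> by (auto simp: \<alpha>_def)
  have S': "S' \<subseteq> {..<N}" using S by (simp add: S'_def)
  have card: "card S' = Suc (card S)" using S finite_subset[OF S(1)] by (simp add: S'_def)
  define E where "E g = {xs \<in> records A (qk A). e g (qphi A xs) \<le> \<alpha>}" for g
  have "3/4 \<le> (\<Sum>xs\<in>E g. (cmod (amp A g xs))\<^sup>2)" if "g \<in> F" for g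
    using success_prob_ge[of r A e g \<alpha>] Q err[OF that] \<alpha> by (simp add: E_def)
  moreover have "E (f S) \<inter> E (f S') = {}"
  proof (rule ccontr)
    assume "E (f S) \<inter> E (f S') \<noteq> {}"
    then obtain xs where "e (f S) (qphi A xs) \<le> \<alpha>" "e (f S') (qphi A xs) \<le> \<alpha>" by (auto simp: E_def)
    then have "\<bar>clip (qphi A xs) - (1/2 - a * card S)\<bar> \<le> \<alpha>" "\<bar>clip (qphi A xs) - (1/2 - a * card S')\<bar> \<le> \<alpha>"
      using err_ge[OF S(1) phi[of xs]] err_ge[OF S' phi[of xs]] by linarith+
    moreover have "a * card S' = a * card S + a" by (simp add: card algebra_simps)
    ultimately show False using \<alpha>(2) by linarith
  qed
  ultimately have "cmod (overlap A (f S) (f S') (qk A)) \<le> 7/8"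
    using f_in_F S(1) S' by (intro overlap_le[OF Q, where E = "E (f S)" and E' = "E (f S')"]) (auto simp: E_def)
  moreover have "1 - cmod (overlap A (f S) (f S') (qk A))
      \<le> total_weight A (cell_blocks j) (f S) + total_weight A (cell_blocks j) (f S')"
  proof (rule overlap_ge[OF Q])
    fix xs i assume i: "i \<in> qZ (qstage A xs)" "i \<notin> cell_blocks j (qstage A xs)"
    then have "fst (qtau (qstage A xs) i) \<in> {0..1}" "snd (qtau (qstage A xs) i) \<le> r"
      using Q[of xs] by (auto simp: qawm_valid_def)
    then show "answer (qstage A xs) (f S) i = answer (qstage A xs) (f S') i"
      unfolding answer_def using i S' S(1) by (intro dd_local) (auto simp: cell_blocks_def S'_def)
  qed
  ultimately show ?thesis unfolding S'_def by linarith
qed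

text \<open>Every pair \<open>S\<close>, \<open>insert j S\<close> between the two middle layers requires query weight at least 1/8 on
  the blocks of \<open>j\<close>, whereas for a fixed set the weights over all \<open>j\<close> sum to at most the number of
  queries.\<close>

theorem comp_quant_ge:
  assumes N: "N = 2 * k + 1" and \<epsilon>: "2 * \<epsilon> < a"
  shows "ennreal ((real k + 1) / 16) \<le> comp_quant r F e \<epsilon>"
  unfolding comp_quant_def
proof (rule INF_greatest)
  fix A assume "A \<in> {A. qalg_adm r A \<and> (\<forall>f\<in>F. qerr e f A \<le> \<epsilon>)}"
  then have Q: "\<And>xs. qawm_valid r (qstage A xs)" and phi: "\<And>xs. qphi A xs \<in> {0..1}"
    and err: "\<And>g. g \<in> F \<Longrightarrow> qerr e g A \<le> \<epsilon>"
    by (auto simp: qalg_adm_def)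
  define s where "s l = (SUP ps \<in> records A l. ennreal (real (qn (qstage A ps))))" for l
  have qcost: "qcost A = (\<Sum>l<qk A. s l)" by (simp add: qcost_def s_def records_def)
  show "ennreal ((real k + 1) / 16) \<le> qcost A"
  proof (cases "qcost A = \<top>")
    case False
    define T where "T l = enn2real (s l)" for l
    have sT: "s l = ennreal (T l)" if "l < qk A" for l
    proof -
      have "s l \<noteq> \<top>" using False that by (auto simp: qcost)
      then show ?thesis by (simp add: T_def less_top)
    qed
    have T0: "0 \<le> T l" for l by (simp add: T_def)
    have T: "real (qn (qstage A xs)) \<le> T l" if "l < qk A" "xs \<in> records A l" for l xs
    proof -
      have "ennreal (real (qn (qstage A xs))) \<le> s l" unfolding s_def using that(2) by (rule SUP_upper)
      then show ?thesis using sT[OF that(1)] T0 by simp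
    qed
    define t where "t = (\<Sum>l<qk A. T l)"
    define w where "w j S = total_weight A (cell_blocks j) (f S)" for j S
    have w: "(\<Sum>j\<in>J. w j S) \<le> t" if "finite J" for J S
      unfolding w_def t_def
      by (rule sum_total_weight_le[OF Q that _ T]) (auto simp: cell_blocks_def)
    define X where "X c = {S. S \<subseteq> {..<N} \<and> card S = c}" for c
    have fin: "finite (X c)" for c by (rule finite_subset[of _ "Pow {..<N}"]) (auto simp: X_def)
    \<comment> \<open>Here \<open>N\<close> must be odd: the layers \<open>k\<close> and
      \<open>k + 1\<close> are complementary, hence equally large.\<close>
    have card_X: "card (X k) = N choose k" "card (X (Suc k)) = N choose k"
      using n_subsets[of "{..<N}" k] n_subsets[of "{..<N}" "Suc k"] binomial_symmetric[of k N] N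
      by (simp_all add: X_def)
    have "real (N choose k) * ((real k + 1) / 8) = (\<Sum>S\<in>X k. \<Sum>j\<in>{..<N} - S. 1/8)"
    proof -
      have "card ({..<N} - S) = Suc k" if "S \<in> X k" for S
        using that N finite_subset[of S "{..<N}"] by (auto simp: X_def card_Diff_subset)
      then show ?thesis by (simp add: card_X)
    qed
    also have "\<dots> \<le> (\<Sum>S\<in>X k. \<Sum>j\<in>{..<N} - S. w j S + w j (insert j S))"
      unfolding w_def using edge_weight_ge[OF Q phi err \<epsilon>]
      by (intro sum_mono) (auto simp: X_def)
    also have "\<dots> = (\<Sum>S\<in>X k. \<Sum>j\<in>{..<N} - S. w j S) + (\<Sum>S\<in>X k. \<Sum>j\<in>{..<N} - S. w j (insert j S))"
      by (simp add: sum.distrib)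
    also have "(\<Sum>S\<in>X k. \<Sum>j\<in>{..<N} - S. w j (insert j S)) = (\<Sum>S\<in>X (Suc k). \<Sum>j\<in>S. w j S)"
    proof -
      have fS: "finite S" if "S \<in> X c" for S c using that finite_subset by (auto simp: X_def)
      \<comment> \<open>Pairs are recounted by their upper member, so that this sum too ranges over
        distinct \<open>j\<close> for a fixed set.\<close>
      have "(\<Sum>(S, j)\<in>(SIGMA S:X k. {..<N} - S). w j (insert j S)) = (\<Sum>(S, j)\<in>(SIGMA S:X (Suc k). S). w j S)"
        by (rule sum.reindex_bij_witness[of _ "\<lambda>(S, j). (S - {j}, j)" "\<lambda>(S, j). (insert j S, j)"])
           (auto simp: X_def insert_absorb finite_subset[OF _ finite_lessThan])
      then show ?thesis using fin fS by (simp add: sum.Sigma)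
    qed
    also have "(\<Sum>S\<in>X k. \<Sum>j\<in>{..<N} - S. w j S) + \<dots> \<le> (\<Sum>S\<in>X k. t) + (\<Sum>S\<in>X (Suc k). t)"
      by (intro add_mono sum_mono w) (auto simp: X_def finite_subset[OF _ finite_lessThan])
    also have "\<dots> = real (N choose k) * (2 * t)" by (simp add: card_X)
    finally have "(real k + 1) / 8 \<le> 2 * t" using N by (simp add: mult_le_cancel_left)
    moreover have "qcost A = ennreal t"
      unfolding qcost t_def using sT T0 by (subst sum_ennreal[symmetric]) auto
    ultimately show ?thesis by (simp add: ennreal_leI)
  qed simp
qed

end

section \<open>Choice of the number of bumps\<close>

text \<open>The constant \<open>\<kappa>\<close> is fixed before \<open>N\<close>: all constraints
  of the class are absorbed by \<delta>, and the factor 4 in \<open>4 * real N\<close> is pulled out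
  of the power.\<close>

lemma hard_family_exists:
  assumes "0 < \<rho>" "\<rho> \<le> 1" "1 < D" "0 < H" "\<gamma> \<le> 2/3"
  obtains \<kappa> :: real where "0 < \<kappa>"
    "\<And>N. 1 \<le> N \<Longrightarrow> \<exists>f loc. hard_family r N (\<kappa> * real N powr (- (r + \<rho> + 1))) f (Fdens r \<rho> D H) err_res loc
        \<and> hard_family r N (\<kappa> * real N powr (- (r + \<rho> + 1))) f (Fdens_low r \<rho> D H \<gamma>) err_abs loc"
proof -
  obtain B A C m where "bump r B A C m"
    using bump_exists .
  then interpret bump r B A C m .
  \<comment> \<open>The three terms secure positivity of the density, the derivative bound
    \<open>D\<close> and the Hoelder constant \<open>H\<close>, in this order.\<close>
  define \<delta> where "\<delta> = min (1/4) (min (D - 1) (H / 2)) / C"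
  have C: "0 < C" using C_ge_1 by simp
  have small: "0 < \<delta>" "\<delta> * C \<le> 1/4" "\<delta> * C \<le> D - 1" "\<delta> * (2 * C) \<le> H"
    using C assms by (auto simp: \<delta>_def min_def)
  define \<kappa> where "\<kappa> = \<delta> * m * 4 powr (- (r + \<rho> + 1))"
  have "0 < \<kappa>" using small m_pos by (simp add: \<kappa>_def)
  moreover have "\<exists>f loc. hard_family r N (\<kappa> * real N powr (- (r + \<rho> + 1))) f (Fdens r \<rho> D H) err_res loc
        \<and> hard_family r N (\<kappa> * real N powr (- (r + \<rho> + 1))) f (Fdens_low r \<rho> D H \<gamma>) err_abs loc"
    if "1 \<le> N" for N
  proof -
    interpret bump_family r B A C m \<rho> \<delta> N
      by unfold_locales (use assms small that in auto)
    have "\<kappa> * real N powr (- (r + \<rho> + 1)) = shift"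
      by (simp add: \<kappa>_def shift_def powr_mult)
    moreover have "hard_family r N shift fam (Fdens_low r \<rho> D H \<gamma>) err_abs cell"
    proof
      show "fam S \<in> Fdens_low r \<rho> D H \<gamma>" if "S \<subseteq> {..<N}" for S
        using that small(3,4) assms(5) by (rule fam_in_class)
    qed (rule shift_pos dd_fam_local err_abs_fam; assumption)+
    moreover have "hard_family r N shift fam (Fdens r \<rho> D H) err_res cell"
    proof
      show "fam S \<in> Fdens r \<rho> D H" if "S \<subseteq> {..<N}" for S
        using fam_in_class[OF that small(3,4) assms(5)] by (simp add: Fdens_low_def)
    qed (rule shift_pos dd_fam_local err_res_fam; assumption)+
    ultimately show ?thesis by (intro exI[of _ fam] exI[of _ cell]) simp
  qed
  ultimately show thesis using that by blast
qed

text \<open>\<open>2 * k + 1\<close> is the largest odd number not exceeding the solution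
  \<open>t\<close> of \<open>\<kappa> * t powr (- s) = \<epsilon>\<close>;
  \<open>\<epsilon> < \<kappa>\<close> gives \<open>t > 1\<close>, and rounding loses at most the
  factor 4.\<close>

lemma odd_size_exists:
  fixes \<kappa> s \<epsilon> :: real
  assumes "0 < \<kappa>" "0 < s" "0 < \<epsilon>" "\<epsilon> < \<kappa>"
  obtains k :: nat where "\<epsilon> \<le> \<kappa> * real (2 * k + 1) powr (- s)"
    "\<kappa> powr (1 / s) / 4 * \<epsilon> powr (- 1 / s) \<le> real k + 1"
proof -
  define t where "t = (\<kappa> / \<epsilon>) powr (1 / s)"
  have t: "1 < t" using assms by (simp add: t_def)
  define k where "k = nat \<lfloor>(t - 1) / 2\<rfloor>"
  have "real k = real_of_int \<lfloor>(t - 1) / 2\<rfloor>" using t by (simp add: k_def)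
  then have "real k \<le> (t - 1) / 2" "(t - 1) / 2 < real k + 1" by linarith+
  then have k: "real (2 * k + 1) \<le> t" "t / 4 \<le> real k + 1" by simp_all
  have "t powr (- s) \<le> real (2 * k + 1) powr (- s)"
    using k(1) assms by (intro powr_mono2') auto
  moreover have "\<kappa> * t powr (- s) = \<epsilon>"
    using assms by (simp add: t_def powr_powr powr_minus_divide)
  ultimately have "\<epsilon> \<le> \<kappa> * real (2 * k + 1) powr (- s)"
    using assms by (metis mult_left_mono less_imp_le)
  moreover have "\<kappa> powr (1 / s) / 4 * \<epsilon> powr (- 1 / s) = t / 4"
    using assms by (simp add: t_def powr_divide powr_minus_divide)
  ultimately show thesis using that[of k] k(2) by simp
qed

theorem theorem2:
  fixes r :: nat and \<rho> D H \<gamma> :: real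
  assumes "0 < \<rho>" "\<rho> \<le> 1" "1 < D" "0 < H" "0 < \<gamma>" "\<gamma> \<le> 2/3"
  shows "\<exists>cdr crr cqr cda cra cqa \<epsilon>0 :: real.
    0 < cdr \<and> 0 < crr \<and> 0 < cqr \<and> 0 < cda \<and> 0 < cra \<and> 0 < cqa \<and> 0 < \<epsilon>0 \<and>
    (\<forall>\<epsilon>. 0 < \<epsilon> \<and> \<epsilon> < \<epsilon>0 \<longrightarrow>
       comp_det r (Fdens r \<rho> D H) err_res \<epsilon> \<ge> ennreal (cdr * \<epsilon> powr (-1 / (r + \<rho>)))
     \<and> comp_rand TYPE('w) r (Fdens r \<rho> D H) err_res \<epsilon> \<ge> ennreal (crr * \<epsilon> powr (-1 / (r + \<rho> + 1/2)))
     \<and> comp_quant r (Fdens r \<rho> D H) err_res \<epsilon> \<ge> ennreal (cqr * \<epsilon> powr (-1 / (r + \<rho> + 1)))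
     \<and> comp_det r (Fdens_low r \<rho> D H \<gamma>) err_abs \<epsilon> \<ge> ennreal (cda * \<epsilon> powr (-1 / (r + \<rho>)))
     \<and> comp_rand TYPE('w) r (Fdens_low r \<rho> D H \<gamma>) err_abs \<epsilon> \<ge> ennreal (cra * \<epsilon> powr (-1 / (r + \<rho> + 1/2)))
     \<and> comp_quant r (Fdens_low r \<rho> D H \<gamma>) err_abs \<epsilon> \<ge> ennreal (cqa * \<epsilon> powr (-1 / (r + \<rho> + 1))))"
proof -
  obtain \<kappa> :: real where \<kappa>: "0 < \<kappa>" and
    fam: "\<And>N. 1 \<le> N \<Longrightarrow> \<exists>f loc. hard_family r N (\<kappa> * real N powr (- (r + \<rho> + 1))) f (Fdens r \<rho> D H) err_res loc
        \<and> hard_family r N (\<kappa> * real N powr (- (r + \<rho> + 1))) f (Fdens_low r \<rho> D H \<gamma>) err_abs loc"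
    using hard_family_exists[OF assms(1-4,6)] by blast
  \<comment> \<open>\<open>64 = 4 * 16\<close> combines the rounding loss with the 16 of the quantum
    bound, which lies below the \<open>N / 2\<close> of the other settings. The quotient
    \<open>\<kappa> / 4\<close> provides the \<open>4 * \<epsilon>\<close> of the deterministic
    case.\<close>
  define c where "c s = (\<kappa> / 4) powr (1 / s) / 64" for s
  have c: "0 < c s" for s using \<kappa> by (simp add: c_def)
  have size: "\<exists>k. 4 * \<epsilon> \<le> \<kappa> * real (2 * k + 1) powr (- s) \<and> c s * \<epsilon> powr (- 1 / s) \<le> (real k + 1) / 16"
    if "0 < \<epsilon>" "\<epsilon> < \<kappa> / 4" "0 < s" for \<epsilon> s
  proof -
    from \<kappa> have "0 < \<kappa> / 4" by simp
    from odd_size_exists[OF this that(3,1,2)] obtain k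
      where "\<epsilon> \<le> \<kappa> / 4 * real (2 * k + 1) powr (- s)"
        "(\<kappa> / 4) powr (1 / s) / 4 * \<epsilon> powr (- 1 / s) \<le> real k + 1" .
    then show ?thesis by (intro exI[of _ k]) (simp add: c_def mult.commute)
  qed
  have det: "ennreal (c (r + \<rho>) * \<epsilon> powr (-1 / (r + \<rho>))) \<le> comp_det r (Fdens r \<rho> D H) err_res \<epsilon>
      \<and> ennreal (c (r + \<rho>) * \<epsilon> powr (-1 / (r + \<rho>))) \<le> comp_det r (Fdens_low r \<rho> D H \<gamma>) err_abs \<epsilon>"
    if \<epsilon>: "0 < \<epsilon>" "\<epsilon> < \<kappa> / 4" for \<epsilon>
  proof -
    obtain k where k: "4 * \<epsilon> \<le> \<kappa> * real (2 * k + 1) powr (- (r + \<rho>))"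
        "c (r + \<rho>) * \<epsilon> powr (- 1 / (r + \<rho>)) \<le> (real k + 1) / 16"
      using size[OF \<epsilon>, of "r + \<rho>"] assms(1) by auto
    define N where "N = 2 * k + 1"
    obtain f loc where f: "hard_family r N (\<kappa> * real N powr (- (r + \<rho> + 1))) f (Fdens r \<rho> D H) err_res loc"
        "hard_family r N (\<kappa> * real N powr (- (r + \<rho> + 1))) f (Fdens_low r \<rho> D H \<gamma>) err_abs loc"
      using fam[of N] by (auto simp: N_def)
    have "real N powr (- (r + \<rho> + 1)) * real N = real N powr (- (r + \<rho> + 1)) * real N powr 1"
      by (simp add: N_def)
    also have "\<dots> = real N powr (- (r + \<rho>))" unfolding powr_add[symmetric] by simp
    finally have powr_N: "real N powr (- (r + \<rho> + 1)) * real N = real N powr (- (r + \<rho>))" .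
    have "4 * \<epsilon> \<le> \<kappa> * real N powr (- (r + \<rho> + 1)) * N"
      using k(1) unfolding mult.assoc powr_N unfolding N_def .
    note bounds = hard_family.comp_det_ge[OF f(1) this] hard_family.comp_det_ge[OF f(2) this]
    have "(real k + 1) / 16 \<le> N / 2" by (simp add: N_def)
    note le = ennreal_leI[OF order_trans[OF k(2) this]]
    show ?thesis using order_trans[OF le bounds(1)] order_trans[OF le bounds(2)] by (rule conjI)
  qed
  have rand: "ennreal (c (r + \<rho> + 1/2) * \<epsilon> powr (-1 / (r + \<rho> + 1/2))) \<le> comp_rand TYPE('w) r (Fdens r \<rho> D H) err_res \<epsilon>
      \<and> ennreal (c (r + \<rho> + 1/2) * \<epsilon> powr (-1 / (r + \<rho> + 1/2))) \<le> comp_rand TYPE('w) r (Fdens_low r \<rho> D H \<gamma>) err_abs \<epsilon>"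
    if \<epsilon>: "0 < \<epsilon>" "\<epsilon> < \<kappa> / 4" for \<epsilon>
  proof -
    obtain k where k: "4 * \<epsilon> \<le> \<kappa> * real (2 * k + 1) powr (- (r + \<rho> + 1/2))"
        "c (r + \<rho> + 1/2) * \<epsilon> powr (- 1 / (r + \<rho> + 1/2)) \<le> (real k + 1) / 16"
      using size[OF \<epsilon>, of "r + \<rho> + 1/2"] assms(1) by auto
    define N where "N = 2 * k + 1"
    obtain f loc where f: "hard_family r N (\<kappa> * real N powr (- (r + \<rho> + 1))) f (Fdens r \<rho> D H) err_res loc"
        "hard_family r N (\<kappa> * real N powr (- (r + \<rho> + 1))) f (Fdens_low r \<rho> D H \<gamma>) err_abs loc"
      using fam[of N] by (auto simp: N_def)
    \<comment> \<open>Squaring turns the half power of \<open>N\<close> into the full factor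
      \<open>N\<close> of the variance.\<close>
    have "(4 * \<epsilon>)\<^sup>2 \<le> (\<kappa> * real N powr (- (r + \<rho> + 1/2)))\<^sup>2"
      using k(1) \<epsilon> by (intro power_mono) (auto simp: N_def)
    moreover have "(real N powr (- (r + \<rho> + 1/2)))\<^sup>2 = (real N powr (- (r + \<rho> + 1)))\<^sup>2 * N"
    proof -
      have "(real N powr (- (r + \<rho> + 1)))\<^sup>2 * N
          = real N powr (- (r + \<rho> + 1)) * real N powr (- (r + \<rho> + 1)) * real N powr 1"
        by (simp add: N_def power2_eq_square)
      also have "\<dots> = (real N powr (- (r + \<rho> + 1/2)))\<^sup>2"
        unfolding power2_eq_square powr_add[symmetric] by (rule arg_cong[of _ _ "\<lambda>x. real N powr x"]) simp
      finally show ?thesis ..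
    qed
    ultimately have "16 * \<epsilon>\<^sup>2 \<le> (\<kappa> * real N powr (- (r + \<rho> + 1)))\<^sup>2 * N"
      by (simp add: power_mult_distrib mult.assoc)
    then have "8 * \<epsilon>\<^sup>2 \<le> (\<kappa> * real N powr (- (r + \<rho> + 1)))\<^sup>2 * N"
      using zero_le_power2[of \<epsilon>] by linarith
    note bounds = hard_family.comp_rand_ge[OF f(1) this] hard_family.comp_rand_ge[OF f(2) this]
    have "(real k + 1) / 16 \<le> N / 2" by (simp add: N_def)
    note le = ennreal_leI[OF order_trans[OF k(2) this]]
    show ?thesis using order_trans[OF le bounds(1)] order_trans[OF le bounds(2)] by (rule conjI)
  qed
  have quant: "ennreal (c (r + \<rho> + 1) * \<epsilon> powr (-1 / (r + \<rho> + 1))) \<le> comp_quant r (Fdens r \<rho> D H) err_res \<epsilon>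
      \<and> ennreal (c (r + \<rho> + 1) * \<epsilon> powr (-1 / (r + \<rho> + 1))) \<le> comp_quant r (Fdens_low r \<rho> D H \<gamma>) err_abs \<epsilon>"
    if \<epsilon>: "0 < \<epsilon>" "\<epsilon> < \<kappa> / 4" for \<epsilon>
  proof -
    obtain k where k: "4 * \<epsilon> \<le> \<kappa> * real (2 * k + 1) powr (- (r + \<rho> + 1))"
        "c (r + \<rho> + 1) * \<epsilon> powr (- 1 / (r + \<rho> + 1)) \<le> (real k + 1) / 16"
      using size[OF \<epsilon>, of "r + \<rho> + 1"] assms(1) by auto
    define N where "N = 2 * k + 1"
    obtain f loc where f: "hard_family r N (\<kappa> * real N powr (- (r + \<rho> + 1))) f (Fdens r \<rho> D H) err_res loc"
        "hard_family r N (\<kappa> * real N powr (- (r + \<rho> + 1))) f (Fdens_low r \<rho> D H \<gamma>) err_abs loc"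
      using fam[of N] by (auto simp: N_def)
    have "2 * \<epsilon> < \<kappa> * real N powr (- (r + \<rho> + 1))"
      using k(1) \<epsilon> by (simp add: N_def)
    note bounds = hard_family.comp_quant_ge[OF f(1) N_def this] hard_family.comp_quant_ge[OF f(2) N_def this]
    show ?thesis
      using order_trans[OF ennreal_leI[OF k(2)] bounds(1)] order_trans[OF ennreal_leI[OF k(2)] bounds(2)] by (rule conjI)
  qed
  show ?thesis
    by (rule exI[of _ "c (r + \<rho>)"], rule exI[of _ "c (r + \<rho> + 1/2)"], rule exI[of _ "c (r + \<rho> + 1)"],
        rule exI[of _ "c (r + \<rho>)"], rule exI[of _ "c (r + \<rho> + 1/2)"], rule exI[of _ "c (r + \<rho> + 1)"],
        rule exI[of _ "\<kappa> / 4"], intro conjI allI impI)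
       (simp_all only: c det rand quant, simp add: \<kappa>)
qed

end
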